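(* Let $f$ be a principally normalized Hecke-monic function on $\mathcal{M}_{Ell}^{\mathbb{Z}/N\mathbb{Z}}$, and let $F$ be the corresponding vector-valued function, with coefficients $c_{i,k}(n)$. Then in a neighborhood of infinity, $f(1,g,\sigma)-f(g,1,\tau)$ has the product expansion $$p^{-1}\prod_{m>0,\ n\in\frac1N\mathbb{Z}}(1-p^mq^n)^{c_{m,Nn}(mn)},$$ where $p=e^{2\pi i\sigma}$ and $q=e^{2\pi i\tau}$.
   Context: $e(x)=e^{2\pi ix}$; $g$ is a generator of $\mathbb{Z}/N\mathbb{Z}$, written multiplicatively. A function on $\mathcal{M}_{Ell}^{\mathbb{Z}/N\mathbb{Z}}$ is a family of holomorphic functions $f(g^i,g^j,\tau)$, $i,j\in\mathbb{Z}/N$, on the upper half-plane with $f(g^i,g^j,\frac{a\tau+b}{c\tau+d})=f(g^{ai+cj},g^{bi+dj},\tau)$ for $\begin{pmatrix}a&b\\c&d\end{pmatrix}\in SL_2(\mathbb{Z})$. It is principally normalized if each $f(1,g^i,\tau)$ has $q$-expansion $q^{-1}+O(q)$. Define $nT_nf(g^i,g^j,\tau)=\sum_{ad=n,\,0\le b<d}f(g^{di},g^{aj-bi},\frac{a\tau+b}{d})$. $f$ is Hecke-monic if for all $n>0$ and every orbit $O$ of the right action of $SL_2(\mathbb{Z})$ on $(\mathbb{Z}/N)^2$ (these correspond to connected components) there is a monic polynomial $\Phi_{O,n}\in\mathbb{C}[x]$ of degree $n$ with $nT_nf(g^i,g^j,\tau)=\Phi_{O,n}(f(g^i,g^j,\tau))$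 for all $(i,j)\in O$. $F_{i,k}(\tau)=\frac1N\sum_{j\in\mathbb{Z}/N}e(-jk/N)f(g^i,g^j,\tau)$, and $c_{i,k}(n)$, $n\in\frac1N\mathbb{Z}$, is its $q^n$ coefficient. "Neighborhood of infinity" refers to $\sigma,\tau$ near the cusp $(i\infty,i\infty)$; the expansion is that of an element of $p^{-1}\mathbb{C}((q^{1/N}))[[p]]$, with non-integral powers read via $\log(1-x)=-\sum_{i\ge1}x^i/i$, on the region where the series converges. *)

theory Defs
  imports "HOL-Complex_Analysis.Complex_Analysis" "HOL-Number_Theory.Cong"
begin

text \<open>
  A pair $(g^i, g^j)$ of elements of the cyclic group of order $N$ is represented by the integer
  exponents \<open>i\<close>, \<open>j\<close>; families indexed by such pairs are functions of \<open>i\<close> and \<open>j\<close> that depend only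
  on their residues modulo \<open>N\<close> (for arguments in the upper half-plane).
\<close>

definition uhp :: "complex set" where
  "uhp = {\<tau>. Im \<tau> > 0}"

definition e2pi :: "complex \<Rightarrow> complex" where
  "e2pi z = exp (2 * of_real pi * \<i> * z)"

definition function_on_M_Ell :: "nat \<Rightarrow> (int \<Rightarrow> int \<Rightarrow> complex \<Rightarrow> complex) \<Rightarrow> bool" where
  "function_on_M_Ell N f \<longleftrightarrow>
     (\<forall>i j i' j'. \<forall>\<tau>\<in>uhp. [i = i'] (mod int N) \<longrightarrow> [j = j'] (mod int N) \<longrightarrow> f i j \<tau> = f i' j' \<tau>) \<and>
     (\<forall>i j. f i j holomorphic_on uhp) \<and>
     (\<forall>a b c d :: int. a * d - b * c = 1 \<longrightarrow>
        (\<forall>i j. \<forall>\<tau>\<in>uhp. f i j ((of_int a * \<tau> + of_int b) / (of_int c * \<tau> + of_int d)) =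
                       f (a * i + c * j) (b * i + d * j) \<tau>))"

text \<open>
  \<open>has_q_expansion N F c\<close>: the function \<open>F\<close> on the upper half-plane has the (a priori two-sided)
  expansion $\sum_{l \in Z} c(l) q^{l/N}$, where $q^{l/N}$ means \<open>e2pi (l * \<tau> / N)\<close>.  So \<open>q_coeff N F l\<close>
  is the coefficient of $q^{l/N}$, not of $q^l$.
\<close>

definition has_q_expansion :: "nat \<Rightarrow> (complex \<Rightarrow> complex) \<Rightarrow> (int \<Rightarrow> complex) \<Rightarrow> bool" where
  "has_q_expansion N F c \<longleftrightarrow>
     (\<forall>\<tau>\<in>uhp. ((\<lambda>l. c l * e2pi (of_int l * \<tau> / of_nat N)) has_sum F \<tau>) UNIV)"

definition q_coeff :: "nat \<Rightarrow> (complex \<Rightarrow> complex) \<Rightarrow> int \<Rightarrow> complex" where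
  "q_coeff N F = (THE c. has_q_expansion N F c)"

definition principally_normalized :: "(int \<Rightarrow> int \<Rightarrow> complex \<Rightarrow> complex) \<Rightarrow> bool" where
  "principally_normalized f \<longleftrightarrow>
     (\<forall>i. \<exists>c. has_q_expansion 1 (f 0 i) c \<and> c (- 1) = 1 \<and> c 0 = 0 \<and> (\<forall>l < - 1. c l = 0))"

text \<open>The operator $n T_n$ (not $T_n$ itself).\<close>

definition nT :: "nat \<Rightarrow> (int \<Rightarrow> int \<Rightarrow> complex \<Rightarrow> complex) \<Rightarrow> int \<Rightarrow> int \<Rightarrow> complex \<Rightarrow> complex" where
  "nT n f i j \<tau> =
     (\<Sum>(a, b, d) \<in> {(a :: nat, b :: nat, d :: nat). a * d = n \<and> b < d}.
        f (int d * i) (int a * j - int b * i) ((of_nat a * \<tau> + of_nat b) / of_nat d))"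

text \<open>The preimage in pairs of integers of the right $SL_2(Z)$-orbit of $(i, j)$ modulo \<open>N\<close>.\<close>

definition SL2_orbit :: "nat \<Rightarrow> int \<Rightarrow> int \<Rightarrow> (int \<times> int) set" where
  "SL2_orbit N i j =
     {(i', j'). \<exists>a b c d :: int. a * d - b * c = 1 \<and>
        [i' = a * i + c * j] (mod int N) \<and> [j' = b * i + d * j] (mod int N)}"

definition Hecke_monic :: "nat \<Rightarrow> (int \<Rightarrow> int \<Rightarrow> complex \<Rightarrow> complex) \<Rightarrow> bool" where
  "Hecke_monic N f \<longleftrightarrow>
     (\<forall>n > 0. \<forall>i0 j0. \<exists>\<Phi> :: complex poly. degree \<Phi> = n \<and> lead_coeff \<Phi> = 1 \<and>
        (\<forall>(i, j) \<in> SL2_orbit N i0 j0. \<forall>\<tau>\<in>uhp. nT n f i j \<tau> = poly \<Phi> (f i j \<tau>)))"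

definition vv :: "nat \<Rightarrow> (int \<Rightarrow> int \<Rightarrow> complex \<Rightarrow> complex) \<Rightarrow> int \<Rightarrow> int \<Rightarrow> complex \<Rightarrow> complex" where
  "vv N f i k \<tau> =
     1 / of_nat N * (\<Sum>j\<in>{0..<int N}. e2pi (- of_int (j * k) / of_nat N) * f i j \<tau>)"

text \<open>
  In the product, \<open>n\<close> is written as $k / N$ with \<open>k\<close> an integer.  The exponent $c_{m,Nn}(mn)$ is then
  the coefficient of $q^{mk/N}$ in $F_{m,k}$.
\<close>

definition prod_exponent :: "nat \<Rightarrow> (int \<Rightarrow> int \<Rightarrow> complex \<Rightarrow> complex) \<Rightarrow> nat \<Rightarrow> int \<Rightarrow> complex" where
  "prod_exponent N f m k = q_coeff N (vv N f (int m) k) (int m * k)"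

definition pq_monomial :: "nat \<Rightarrow> complex \<Rightarrow> complex \<Rightarrow> nat \<Rightarrow> int \<Rightarrow> complex" where
  "pq_monomial N \<sigma> \<tau> m k = e2pi (of_nat m * \<sigma>) * e2pi (of_int k / of_nat N * \<tau>)"

text \<open>
  $(1 - x)^c$ through the logarithm series.  Unlike \<open>(1 - x) powr c\<close> this is \<open>1\<close> for \<open>c = 0\<close>
  and every \<open>x\<close>, including \<open>x = 1\<close>.
\<close>

definition one_minus_pow :: "complex \<Rightarrow> complex \<Rightarrow> complex" where
  "one_minus_pow x c = exp (c * (- (\<Sum>i. x ^ Suc i / of_nat (Suc i))))"

text \<open>
  The point $(\sigma, \tau)$ lies in the region where the logarithm of the product, expanded into
  monomials in \<open>p\<close> and $q^{1/N}$, converges absolutely.  In particular $|p^m q^n| < 1$ whenever the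
  exponent of $1 - p^m q^n$ is nonzero.
\<close>

definition log_series_converges ::
  "nat \<Rightarrow> (int \<Rightarrow> int \<Rightarrow> complex \<Rightarrow> complex) \<Rightarrow> complex \<Rightarrow> complex \<Rightarrow> bool" where
  "log_series_converges N f \<sigma> \<tau> \<longleftrightarrow>
     (\<lambda>(m, k, i). norm (prod_exponent N f m k * (pq_monomial N \<sigma> \<tau> m k ^ i / of_nat i)))
       summable_on ({1 :: nat..} \<times> (UNIV :: int set) \<times> {1 :: nat..})"

definition has_product_expansion ::
  "nat \<Rightarrow> (int \<Rightarrow> int \<Rightarrow> complex \<Rightarrow> complex) \<Rightarrow> complex \<Rightarrow> complex \<Rightarrow> complex \<Rightarrow> bool" where
  "has_product_expansion N f \<sigma> \<tau> z \<longleftrightarrow>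
     ((\<lambda>X. e2pi (- \<sigma>) * (\<Prod>(m, k)\<in>X. one_minus_pow (pq_monomial N \<sigma> \<tau> m k) (prod_exponent N f m k)))
        \<longlongrightarrow> z) (finite_subsets_at_top ({1 :: nat..} \<times> (UNIV :: int set)))"

end

theory Submission imports Defs begin

text \<open>
  Put $x = f(g, 1, \tau)$ and $t_n = n T_n f(g, 1, \tau)$. Regrouping the logarithm of the product by
  powers of $p$ gives $-\sum_{n > 0} t_n p^n / n$. Since $(1, g)$ and $(g, 1)$ lie in one orbit,
  $t_n = \Phi_n(x)$ with the same monic $\Phi_n$ for which
  $\Phi_n(f(1, g, \sigma)) = n T_n f(1, g, \sigma) = p^{-n} + n a_n p + O(p^2)$, where
  $f(1, g, \sigma) = p^{-1} + \sum_{l > 0} a_l p^l$. Comparing expansions at infinity yields the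
  recurrence of the Faber polynomials for the $\Phi_n$, which says that
  $\exp(-\sum_n \Phi_n(x) p^n / n)$ and $p (f(1, g, \sigma) - x)$ satisfy the same linear
  differential equation in $p$.

  That the other $f(g^i, g^j, \tau)$ have at most poles at infinity is not assumed; it follows from the Hecke relation with $n = N + 1$, and $SL_2(Z)$ carries the resulting growth bound to the
  real axis, where it controls the exponents $c_{m, Nn}(mn)$ in terms of $m$ and $n$.
\<close>

subsection \<open>Expansions in powers of $q$\<close>

text \<open>The obstacle is convergence. On a fixed horizontal line, the growth of f bounds
  c_{m,Nn}(mn) only by exp(O(m) + O(mn)), and no factor |p^m q^n| compensates for the mn. On the
  line Im \<tau> = 1/m the factor |q^(-mn)| becomes e^(2 pi n), while f is at most e^(Am) there; so
  the exponents grow at most geometrically in m and n separately. The coefficient index mn comes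
  from the Hecke operators: in n T_n f(g, 1, \<tau>), the phases of Fourier inversion cancel against
  those of the translations b/d, and the sum over b keeps only exponents divisible by d = m. The
  passage from (1, g) to (g, 1) goes through C[x]. At (1, g) the function has a pole at infinity, so
  a relation that holds up to o(1) on the imaginary axis is an identity of polynomials. It may then
  be evaluated at x = f(g, 1, \<tau>), whose own expansion never enters.\<close>

lemma e2pi_add: "e2pi (a + b) = e2pi a * e2pi b"
  by (simp add: e2pi_def exp_add ring_distribs)

lemma e2pi_0 [simp]: "e2pi 0 = 1"
  by (simp add: e2pi_def)

lemma e2pi_nonzero [simp]: "e2pi z \<noteq> 0"
  by (simp add: e2pi_def)

lemma e2pi_minus: "e2pi (- z) = inverse (e2pi z)"
  by (simp add: e2pi_def exp_minus)

lemma norm_e2pi: "norm (e2pi z) = exp (- 2 * pi * Im z)"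
  by (simp add: e2pi_def)

lemma e2pi_power: "e2pi z ^ n = e2pi (of_nat n * z)"
  by (simp add: e2pi_def mult_ac flip: exp_of_nat_mult)

lemma e2pi_eq_1_iff: "e2pi z = 1 \<longleftrightarrow> z \<in> \<int>"
proof
  assume "e2pi z = 1"
  then obtain n :: int where "Im z = 0" "Re z * (2 * pi) = of_int (2 * n) * pi"
    by (auto simp: e2pi_def exp_eq_1 mult_ac)
  then have "z = of_int n"
    by (auto simp: complex_eq_iff)
  then show "z \<in> \<int>" by simp
next
  assume "z \<in> \<int>"
  then obtain n :: int where "z = of_int n" by (elim Ints_cases)
  then show "e2pi z = 1"
    by (auto simp: e2pi_def exp_eq_1)
qed

lemma e2pi_of_int [simp]: "e2pi (of_int n) = 1"
  by (simp add: e2pi_eq_1_iff)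

lemma e2pi_holomorphic [holomorphic_intros]:
  "g holomorphic_on S \<Longrightarrow> (\<lambda>z. e2pi (g z)) holomorphic_on S"
  unfolding e2pi_def by (intro holomorphic_intros)

section \<open>Sums over roots of unity and averages over translates\<close>

lemma of_int_div_of_nat_in_Ints_iff:
  assumes "M > 0"
  shows "(of_int r / of_nat M :: complex) \<in> \<int> \<longleftrightarrow> int M dvd r"
proof
  assume "(of_int r / of_nat M :: complex) \<in> \<int>"
  then obtain k where "of_int r / of_nat M = (of_int k :: complex)" by (elim Ints_cases)
  then have "of_int r = (of_int (k * int M) :: complex)"
    using assms by (simp add: field_simps)
  then have "r = k * int M" by (simp only: of_int_eq_iff)
  then show "int M dvd r" by simp
next
  assume "int M dvd r"
  then obtain k where "r = int M * k" by (elim dvdE)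
  then show "(of_int r / of_nat M :: complex) \<in> \<int>" using assms by simp
qed

lemma sum_e2pi_multiples:
  assumes "M > 0"
  shows "(\<Sum>b<M. e2pi (of_nat b * (of_int r / of_nat M))) = (if int M dvd r then of_nat M else 0)"
proof -
  define w where "w = e2pi (of_int r / of_nat M)"
  have eq: "e2pi (of_nat b * (of_int r / of_nat M)) = w ^ b" for b
    by (simp add: w_def e2pi_power)
  have w1: "w = 1 \<longleftrightarrow> int M dvd r"
    unfolding w_def e2pi_eq_1_iff using assms by (rule of_int_div_of_nat_in_Ints_iff)
  have "w ^ M = 1"
    using assms by (simp add: w_def e2pi_power)
  then show ?thesis
    unfolding eq using w1 by (cases "w = 1") (simp_all add: geometric_sum)
qed

lemma has_sum_diff:
  fixes f :: "'a \<Rightarrow> 'b :: topological_ab_group_add"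
  assumes "(f has_sum a) A" "(g has_sum b) A"
  shows "((\<lambda>x. f x - g x) has_sum (a - b)) A"
  using has_sum_add[OF assms(1), of "\<lambda>x. - g x" "- b"] assms(2) by (simp add: has_sum_uminus)

lemma has_sum_finite_sum:
  fixes g :: "'a \<Rightarrow> 'b \<Rightarrow> 'c :: topological_comm_monoid_add"
  assumes "\<And>x. x \<in> X \<Longrightarrow> (g x has_sum s x) A"
  shows "((\<lambda>y. \<Sum>x\<in>X. g x y) has_sum (\<Sum>x\<in>X. s x)) A"
  using assms by (induction X rule: infinite_finite_induct) (auto intro!: has_sum_add)

text \<open>The substitution \<tau> = N z makes all exponents integral, so uniqueness of
  coefficients needs a proof only for N = 1.\<close>

lemma has_q_expansion_iff_1:
  assumes "N > 0"
  shows "has_q_expansion N F c \<longleftrightarrow> has_q_expansion 1 (\<lambda>z. F (of_nat N * z)) c"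
proof -
  have 1: "of_nat N * z \<in> uhp \<longleftrightarrow> z \<in> uhp" for z
    using assms by (simp add: uhp_def zero_less_mult_iff)
  have "(\<forall>\<tau>\<in>uhp. P \<tau>) \<longleftrightarrow> (\<forall>z\<in>uhp. P (of_nat N * z))" for P
  proof safe
    fix \<tau> assume *: "\<forall>z\<in>uhp. P (of_nat N * z)" "\<tau> \<in> uhp"
    then have "\<tau> / of_nat N \<in> uhp" using assms by (simp add: uhp_def)
    with * show "P \<tau>" using assms by fastforce
  qed (use 1 in auto)
  from this[of "\<lambda>\<tau>. ((\<lambda>l. c l * e2pi (of_int l * \<tau> / of_nat N)) has_sum F \<tau>) UNIV"]
  show ?thesis using assms by (simp add: has_q_expansion_def)
qed

text \<open>Phase and translation together multiply the r-th term by e(b(r - l)/M), and the sum over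
  b is orthogonality of characters. Large M isolates a coefficient; l = 0 expands a Hecke
  operator.\<close>

lemma has_sum_hecke_shift:
  assumes F: "has_q_expansion 1 F c" and \<tau>: "\<tau> \<in> uhp" and M: "M > 0"
  shows "((\<lambda>r. if int M dvd r - l then of_nat M * (c r * e2pi (of_int r * \<tau>)) else 0) has_sum
          (\<Sum>b<M. e2pi (- (of_nat b * of_int l / of_nat M)) * F (\<tau> + of_nat b / of_nat M))) UNIV"
proof -
  have *: "((\<lambda>r. c r * e2pi (of_int r * \<tau>) * e2pi (of_nat b * (of_int (r - l) / of_nat M))) has_sum
        e2pi (- (of_nat b * of_int l / of_nat M)) * F (\<tau> + of_nat b / of_nat M)) UNIV" for b
  proof -
    have "\<tau> + of_nat b / of_nat M \<in> uhp" using \<tau> by (simp add: uhp_def)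
    with F have "((\<lambda>r. c r * e2pi (of_int r * (\<tau> + of_nat b / of_nat M))) has_sum
          F (\<tau> + of_nat b / of_nat M)) UNIV"
      by (simp add: has_q_expansion_def)
    from has_sum_cmult_right[OF this, of "e2pi (- (of_nat b * of_int l / of_nat M))"]
    show ?thesis
      by (rule back_subst[where P = "\<lambda>g. (g has_sum _) _"])
         (simp add: fun_eq_iff diff_divide_distrib ring_distribs mult_ac add_diff_eq
               flip: e2pi_add)
  qed
  have "((\<lambda>r. c r * e2pi (of_int r * \<tau>) *
             (\<Sum>b<M. e2pi (of_nat b * (of_int (r - l) / of_nat M)))) has_sum
          (\<Sum>b<M. e2pi (- (of_nat b * of_int l / of_nat M)) * F (\<tau> + of_nat b / of_nat M))) UNIV"
    unfolding sum_distrib_left by (intro has_sum_finite_sum *)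
  then show ?thesis
    unfolding sum_e2pi_multiples[OF M]
    by (rule back_subst[where P = "\<lambda>g. (g has_sum _) _"]) (auto simp: fun_eq_iff)
qed

lemma has_sum_hecke:
  assumes F: "has_q_expansion 1 F c" and \<tau>: "\<tau> \<in> uhp" and a: "a > 0" and d: "d > 0"
  shows "((\<lambda>s. of_nat d * c (int d * s) * e2pi (of_int s * (of_nat a * \<tau>))) has_sum
          (\<Sum>b<d. F ((of_nat a * \<tau> + of_nat b) / of_nat d))) UNIV"
proof -
  define \<tau>' where "\<tau>' = of_nat a * \<tau> / of_nat d"
  have "\<tau>' \<in> uhp" using \<tau> a d by (simp add: uhp_def \<tau>'_def)
  from has_sum_hecke_shift[OF F this d, of 0]
  have "((\<lambda>r. if int d dvd r then of_nat d * (c r * e2pi (of_int r * \<tau>')) else 0) has_sum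
          (\<Sum>b<d. F ((of_nat a * \<tau> + of_nat b) / of_nat d))) UNIV"
    by (simp add: \<tau>'_def add_divide_distrib)
  also have "?this \<longleftrightarrow> ((\<lambda>r. of_nat d * (c r * e2pi (of_int r * \<tau>'))) has_sum
          (\<Sum>b<d. F ((of_nat a * \<tau> + of_nat b) / of_nat d))) (range (\<lambda>s. int d * s))"
    by (rule has_sum_cong_neutral) auto
  also have "\<dots> \<longleftrightarrow> ?thesis"
    using d by (subst has_sum_reindex) (auto simp: inj_on_def o_def \<tau>'_def mult_ac)
  finally show ?thesis .
qed

text \<open>
  The coefficient of $q^l$ is isolated by averaging $q^{-l} F$ over the $M$ translates
  $\tau + b / M$; the aliased terms $r \equiv l$ modulo $M$, $r \neq l$, vanish as $M$ grows.
\<close>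

lemma q_expansion_coeff_bound:
  assumes F: "has_q_expansion 1 F c" and y: "y > 0"
    and B: "\<And>\<tau>. Im \<tau> = y \<Longrightarrow> norm (F \<tau>) \<le> B"
  shows "norm (c l) \<le> B * exp (2 * pi * of_int l * y)"
proof -
  define \<tau> where "\<tau> = Complex 0 y"
  have \<tau>: "\<tau> \<in> uhp" and Im\<tau>: "Im \<tau> = y" using y by (auto simp: \<tau>_def uhp_def)
  define u where "u r = c r * e2pi (of_int r * \<tau>)" for r
  have "(u has_sum F \<tau>) UNIV" using F \<tau> by (simp add: has_q_expansion_def u_def [abs_def])
  then have "u summable_on UNIV" by (rule has_sum_imp_summable)
  then have su: "(\<lambda>r. norm (u r)) summable_on UNIV"
    by (simp add: summable_on_iff_abs_summable_on_complex)
  have "norm (u l) \<le> B + e" if e: "e > 0" for e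
  proof -
    obtain X where X: "finite X" "dist (\<Sum>r\<in>X. norm (u r)) (\<Sum>\<^sub>\<infinity>r. norm (u r)) \<le> e"
      using has_sum_finite_approximation[OF has_sum_infsum[OF su] e] by auto
    have tail: "(\<Sum>\<^sub>\<infinity>r\<in>-X. norm (u r)) \<le> e"
    proof -
      have "(\<Sum>\<^sub>\<infinity>r\<in>X \<union> -X. norm (u r)) = (\<Sum>\<^sub>\<infinity>r\<in>X. norm (u r)) + (\<Sum>\<^sub>\<infinity>r\<in>-X. norm (u r))"
        using X su by (intro infsum_Un_disjoint) (auto intro: summable_on_subset)
      then show ?thesis using X by (simp add: dist_norm)
    qed
    \<comment> \<open>M exceeds |r - l| for all r in \<open>X\<close>, so no index in
      \<open>X\<close> other than l survives the averaging; all aliased terms belong to the small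
      tail.\<close>
    define M where "M = Suc (nat (\<Sum>r\<in>X. \<bar>r - l\<bar>))"
    have M: "M > 0" by (simp add: M_def)
    have small: "\<not> int M dvd r - l" if "r \<in> X" "r \<noteq> l" for r
    proof
      assume "int M dvd r - l"
      then have "int M \<le> \<bar>r - l\<bar>" using that(2) by (intro zdvd_imp_le) auto
      also have "\<dots> \<le> (\<Sum>r\<in>X. \<bar>r - l\<bar>)" using that X(1) by (intro member_le_sum) auto
      finally show False by (simp add: M_def)
    qed
    define S where "S = (\<Sum>b<M. e2pi (- (of_nat b * of_int l / of_nat M)) * F (\<tau> + of_nat b / of_nat M))"
    define v where "v r = (if int M dvd r - l then u r else 0)" for r
    have "norm S \<le> (\<Sum>b<M. B)"
      unfolding S_def by (intro sum_norm_le) (auto simp: norm_mult norm_e2pi intro!: B Im\<tau>)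
    then have nS: "norm (S / of_nat M) \<le> B"
      using M by (simp add: norm_divide field_simps)
    have "(\<lambda>r. 1 / of_nat M * (if int M dvd r - l then of_nat M * (c r * e2pi (of_int r * \<tau>)) else 0)) = v"
      using M by (auto simp: v_def u_def fun_eq_iff)
    then have v: "(v has_sum S / of_nat M) UNIV"
      using has_sum_cmult_right[OF has_sum_hecke_shift[OF F \<tau> M, of l], of "1 / of_nat M"]
      unfolding S_def [symmetric] by simp
    have sv: "(\<lambda>r. norm (v r)) summable_on A" for A
      using v summable_on_iff_abs_summable_on_complex has_sum_imp_summable
        summable_on_subset[of _ UNIV A] by blast
    have "v summable_on -{l}" using sv summable_on_iff_abs_summable_on_complex by blast
    then have "infsum v (insert l (-{l})) = v l + infsum v (-{l})"
      by (rule infsum_insert) auto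
    moreover have "insert l (-{l}) = UNIV" by auto
    ultimately have "u l = S / of_nat M - infsum v (-{l})"
      using infsumI[OF v] by (simp add: v_def)
    also have "norm \<dots> \<le> norm (S / of_nat M) + norm (infsum v (-{l}))"
      by (rule norm_triangle_ineq4)
    also have "norm (infsum v (-{l})) \<le> infsum (\<lambda>r. norm (v r)) (-{l})"
      using sv by (rule norm_infsum_bound)
    also have "\<dots> \<le> (\<Sum>\<^sub>\<infinity>r\<in>-X. norm (u r))"
    proof (rule infsum_mono_neutral)
      show "(\<lambda>r. norm (u r)) summable_on -X" using su by (rule summable_on_subset) auto
    qed (use sv small in \<open>auto simp: v_def\<close>)
    finally show ?thesis using nS tail by simp
  qed
  then have "norm (u l) \<le> B" by (rule field_le_epsilon)
  then show ?thesis
    using Im\<tau> by (simp add: u_def norm_mult norm_e2pi exp_minus field_simps)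
qed

text \<open>The difference of two expansions is an expansion of 0, to which the coefficient bound
  applies with B = 0.\<close>

lemma has_q_expansion_unique:
  assumes "N > 0" "has_q_expansion N F c" "has_q_expansion N F c'"
  shows "c = c'"
proof
  fix l
  have "has_q_expansion 1 (\<lambda>_. 0) (\<lambda>l. c l - c' l)"
    using assms(2,3) has_sum_diff unfolding has_q_expansion_iff_1[OF assms(1)]
    by (fastforce simp: has_q_expansion_def left_diff_distrib)
  from q_expansion_coeff_bound[OF this, of 1 0 l] show "c l = c' l" by simp
qed

lemma q_coeff_eq:
  assumes "N > 0" "has_q_expansion N F c"
  shows "q_coeff N F = c"
  unfolding q_coeff_def using assms has_q_expansion_unique by blast

text \<open>F descends to a function of q on the punctured disc. Exponential growth in Im \<tau> is
  polynomial growth in 1/|q|, so multiplication by a power of q makes the singularity at 0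
  removable, and a Taylor series gives the expansion.\<close>

lemma has_q_expansion_exists:
  assumes hol: "F holomorphic_on uhp"
    and per: "\<And>\<tau>. \<tau> \<in> uhp \<Longrightarrow> F (\<tau> + 1) = F \<tau>"
    and gr: "\<And>\<tau>. Im \<tau> \<ge> 1 \<Longrightarrow> norm (F \<tau>) \<le> C * exp (A * Im \<tau>)"
  obtains c where "has_q_expansion 1 F c"
proof -
  define t where "t w = Ln w / (2 * of_real pi * \<i>)" for w
  have e2pi_t: "e2pi (t w) = w" if "w \<noteq> 0" for w
    using that by (simp add: e2pi_def t_def)
  have Im_eq: "Im \<tau> = - ln (norm (e2pi \<tau>)) / (2 * pi)" for \<tau>
    by (simp add: norm_e2pi)
  have pern: "F (\<tau> + of_nat n) = F \<tau>" if "\<tau> \<in> uhp" for \<tau> n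
  proof (induction n)
    case (Suc n)
    have "\<tau> + of_nat n \<in> uhp" using that by (simp add: uhp_def)
    from per[OF this] Suc show ?case by (simp add: add_ac)
  qed auto
  have perz: "F \<tau> = F \<tau>'" if *: "\<tau> \<in> uhp" "\<tau>' \<in> uhp" "e2pi \<tau> = e2pi \<tau>'" for \<tau> \<tau>'
  proof -
    have "e2pi (\<tau> - \<tau>') = 1" using *(3) by (simp add: e2pi_add e2pi_minus diff_conv_add_uminus del: add_uminus_conv_diff)
    then obtain k :: int where k: "\<tau> = \<tau>' + of_int k"
      by (auto simp: e2pi_eq_1_iff elim!: Ints_cases) (metis add.commute diff_add_cancel)
    show ?thesis
    proof (cases "k \<ge> 0")
      case True
      then show ?thesis using pern[OF *(2), of "nat k"] k by simp
    next
      case False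
      then show ?thesis using pern[OF *(1), of "nat (-k)"] k by simp
    qed
  qed
  have uhp_iff: "\<tau> \<in> uhp \<longleftrightarrow> norm (e2pi \<tau>) < 1" for \<tau>
    by (simp add: uhp_def norm_e2pi zero_less_mult_iff)
  define G where "G w = F (t w)" for w
  have G_eq: "G (e2pi \<tau>) = F \<tau>" if "\<tau> \<in> uhp" for \<tau>
    unfolding G_def using that e2pi_t[of "e2pi \<tau>"] by (intro perz) (auto simp: uhp_iff)
  have G_hol: "G holomorphic_on ball 0 1 - {0}"
  proof -
    have "G field_differentiable (at w)" if w: "w \<noteq> 0" "norm w < 1" for w
    proof -
      define r where "r = min (norm w) (1 - norm w)"
      have r: "r > 0" using w by (simp add: r_def)
      have nz: "z \<noteq> 0" "norm z < 1" if "z \<in> ball w r" for z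
      proof -
        show "z \<noteq> 0" using that by (auto simp: r_def dist_norm)
        have "norm z \<le> norm w + dist w z" using norm_triangle_ineq2[of z w] by (simp add: dist_norm norm_minus_commute)
        then show "norm z < 1" using that by (simp add: r_def)
      qed
      \<comment> \<open>\<open>Ln\<close> has a branch cut, but by periodicity G does not depend on
        the choice of logarithm, so a holomorphic one near w suffices.\<close>
      obtain h where h: "h holomorphic_on ball w r" "\<And>z. z \<in> ball w r \<Longrightarrow> z = exp (h z)"
        using contractible_imp_holomorphic_log[of "\<lambda>z. z" "ball w r"] nz(1)
        by (auto simp: convex_imp_contractible)
      define s where "s z = h z / (2 * of_real pi * \<i>)" for z
      have s: "e2pi (s z) = z" if "z \<in> ball w r" for z
        using h(2)[OF that] by (simp add: s_def e2pi_def)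
      have "s holomorphic_on ball w r" unfolding s_def by (intro holomorphic_intros h) auto
      moreover have "s ` ball w r \<subseteq> uhp" using s nz by (auto simp: uhp_iff)
      ultimately have "(F \<circ> s) holomorphic_on ball w r"
        using hol by (intro holomorphic_on_compose_gen[where t = uhp]) auto
      moreover have "(F \<circ> s) z = G z" if "z \<in> ball w r" for z
        using G_eq[of "s z"] s[OF that] nz[OF that] by (auto simp: uhp_iff)
      ultimately have "G holomorphic_on ball w r" by (metis (no_types, lifting) holomorphic_cong)
      then show ?thesis using r by (intro holomorphic_on_imp_differentiable_at[of G "ball w r"]) auto
    qed
    then show ?thesis by (auto simp: holomorphic_on_def intro: field_differentiable_at_within)
  qed
  \<comment> \<open>|q^K| = e^(-2 pi K Im \<tau>) has to cancel e^(A Im \<tau>).\<close>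
  define K where "K = nat \<lceil>\<bar>A\<bar> / (2 * pi)\<rceil>"
  have K: "\<bar>A\<bar> \<le> 2 * pi * real K"
  proof -
    have "\<bar>A\<bar> / (2 * pi) \<le> real K" unfolding K_def by linarith
    then show ?thesis by (simp add: field_simps)
  qed
  have bound: "norm (w ^ K * G w) \<le> \<bar>C\<bar>" if w: "w \<noteq> 0" "norm w < exp (- 2 * pi)" for w
  proof -
    define y where "y = Im (t w)"
    have y: "norm w = exp (- 2 * pi * y)"
      using e2pi_t[OF w(1)] norm_e2pi[of "t w"] by (simp add: y_def)
    then have y1: "y \<ge> 1" using w by simp
    then have "norm (G w) \<le> C * exp (A * y)" using gr[of "t w"] by (simp add: G_def y_def)
    also have "\<dots> \<le> \<bar>C\<bar> * exp (2 * pi * real K * y)"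
      using K y1 by (intro mult_mono) (auto intro: mult_right_mono)
    finally have "norm (w ^ K) * norm (G w) \<le> norm (w ^ K) * (\<bar>C\<bar> * exp (2 * pi * real K * y))"
      by (rule mult_left_mono) auto
    also have nw: "norm (w ^ K) = exp (- (2 * pi * real K * y))"
      by (simp add: norm_power y mult_ac flip: exp_of_nat_mult)
    also have "exp (- (2 * pi * real K * y)) * (\<bar>C\<bar> * exp (2 * pi * real K * y)) = \<bar>C\<bar>"
      by (simp add: exp_minus)
    finally show ?thesis by (simp only: norm_mult nw)
  qed
  have "\<forall>\<^sub>F w in at 0. norm (w ^ K * G w) \<le> \<bar>C\<bar>"
    unfolding eventually_at by (rule exI[of _ "exp (- 2 * pi)"]) (use bound in auto)
  moreover have "(\<lambda>w. w ^ K * G w) holomorphic_on ball 0 1 - {0}"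
    by (intro holomorphic_intros G_hol)
  ultimately obtain g where g: "g holomorphic_on ball 0 1"
    "\<And>w. w \<in> ball 0 1 - {0} \<Longrightarrow> g w = w ^ K * G w"
    using holomorphic_on_extend_bounded[of "\<lambda>w. w ^ K * G w" "ball 0 1" 0] by auto
  define a where "a n = (deriv ^^ n) g 0 / fact n" for n
  have g_sums: "(\<lambda>n. a n * w ^ n) sums g w" if "norm w < 1" for w
    using holomorphic_power_series[OF g(1), of w] that by (simp add: a_def)
  have g_has_sum: "((\<lambda>n. a n * w ^ n) has_sum g w) UNIV" if "norm w < 1" for w
  proof (rule norm_summable_imp_has_sum)
    \<comment> \<open>Convergence at a point of modulus strictly between |w| and 1 makes the
      convergence at w absolute.\<close>
    define r :: complex where "r = of_real ((1 + norm w) / 2)"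
    have "norm r = (1 + norm w) / 2" unfolding r_def norm_of_real by (simp add: abs_of_nonneg)
    then have "norm w < norm r" "norm r < 1" using that by auto
    then show "summable (\<lambda>n. norm (a n * w ^ n))"
      using powser_insidea g_sums sums_summable by blast
  qed (use that g_sums in auto)
  define c where "c l = (if l \<ge> - int K then a (nat (l + int K)) else 0)" for l
  have "has_q_expansion 1 F c"
    unfolding has_q_expansion_def
  proof
    fix \<tau> assume \<tau>: "\<tau> \<in> uhp"
    define w where "w = e2pi \<tau>"
    have w: "w \<noteq> 0" "norm w < 1" using \<tau> by (auto simp: w_def uhp_iff)
    have "((\<lambda>n. inverse (w ^ K) * (a n * w ^ n)) has_sum inverse (w ^ K) * g w) UNIV"
      by (intro has_sum_cmult_right g_has_sum w)
    also have "inverse (w ^ K) * g w = F \<tau>"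
      using g(2)[of w] w G_eq[OF \<tau>] by (simp add: w_def)
    also have "((\<lambda>n. inverse (w ^ K) * (a n * w ^ n)) has_sum F \<tau>) UNIV \<longleftrightarrow>
       ((\<lambda>l. c l * e2pi (of_int l * \<tau>)) has_sum F \<tau>) {- int K..}"
    proof (rule has_sum_reindex_bij_witness[of _ "\<lambda>l. nat (l + int K)" "\<lambda>n. int n - int K"])
      fix n :: nat
      have "of_int (int n - int K) * \<tau> = of_nat n * \<tau> + - (of_nat K * \<tau>)"
        by (simp add: left_diff_distrib)
      then have "e2pi (of_int (int n - int K) * \<tau>) = inverse (w ^ K) * w ^ n"
        by (simp only: w_def e2pi_power e2pi_add e2pi_minus mult.commute)
      then show "c (int n - int K) * e2pi (of_int (int n - int K) * \<tau>) = inverse (w ^ K) * (a n * w ^ n)"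
        by (simp add: c_def)
    qed auto
    also have "\<dots> \<longleftrightarrow> ((\<lambda>l. c l * e2pi (of_int l * \<tau>)) has_sum F \<tau>) UNIV"
      by (rule has_sum_cong_neutral) (auto simp: c_def)
    finally show "((\<lambda>l. c l * e2pi (of_int l * \<tau> / of_nat 1)) has_sum F \<tau>) UNIV" by simp
  qed
  then show ?thesis by (rule that)
qed

section \<open>Growth of polynomials, and Hecke operators as sums over divisors\<close>

lemma poly_norm_bound:
  fixes p :: "complex poly"
  obtains C where "C \<ge> 1" "\<And>z. norm (poly p z) \<le> C * max 1 (norm z) ^ degree p"
proof
  define C where "C = 1 + (\<Sum>i\<le>degree p. norm (coeff p i))"
  show "C \<ge> 1" by (simp add: C_def sum_nonneg)
  fix z
  have "norm (poly p z) \<le> (\<Sum>i\<le>degree p. norm (coeff p i) * max 1 (norm z) ^ degree p)"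
    unfolding poly_altdef
  proof (rule sum_norm_le)
    fix i assume i: "i \<in> {..degree p}"
    have "norm z ^ i \<le> max 1 (norm z) ^ i" by (intro power_mono) auto
    also have "\<dots> \<le> max 1 (norm z) ^ degree p" using i by (intro power_increasing) auto
    finally show "norm (coeff p i * z ^ i) \<le> norm (coeff p i) * max 1 (norm z) ^ degree p"
      by (simp add: norm_mult norm_power mult_left_mono)
  qed
  also have "\<dots> \<le> C * max 1 (norm z) ^ degree p"
    by (simp add: C_def distrib_right flip: sum_distrib_right)
  finally show "norm (poly p z) \<le> C * max 1 (norm z) ^ degree p" .
qed

lemma nT_conv_divisors:
  assumes "n > 0"
  shows "nT n f i j \<tau> = (\<Sum>d | d dvd n. \<Sum>b<d.
    f (int d * i) (int (n div d) * j - int b * i) ((of_nat (n div d) * \<tau> + of_nat b) / of_nat d))"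
proof -
  have "finite {d. d dvd n}" using assms by simp
  then have "(\<Sum>d | d dvd n. \<Sum>b<d.
    f (int d * i) (int (n div d) * j - int b * i) ((of_nat (n div d) * \<tau> + of_nat b) / of_nat d)) =
    (\<Sum>(d, b) \<in> Sigma {d. d dvd n} (\<lambda>d. {..<d}).
    f (int d * i) (int (n div d) * j - int b * i) ((of_nat (n div d) * \<tau> + of_nat b) / of_nat d))"
    by (intro sum.Sigma) auto
  also have "\<dots> = nT n f i j \<tau>"
    unfolding nT_def
    by (rule sum.reindex_bij_witness[of _ "\<lambda>(a, b, d). (d, b)" "\<lambda>(d, b). (n div d, b, d)"])
       (use assms in auto)
  finally show ?thesis ..
qed

lemma SL2_orbit_self: "(i, j) \<in> SL2_orbit N i j"
  unfolding SL2_orbit_def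
  by (rule CollectI, unfold prod.case,
      rule exI[of _ 1], rule exI[of _ 0], rule exI[of _ 0], rule exI[of _ 1]) simp

subsection \<open>Growth of Hecke-monic functions\<close>

locale hecke_monic_function =
  fixes N :: nat and f :: "int \<Rightarrow> int \<Rightarrow> complex \<Rightarrow> complex"
  assumes N_pos: "N > 0"
    and f_M_Ell: "function_on_M_Ell N f"
    and f_normalized: "principally_normalized f"
    and f_Hecke_monic: "Hecke_monic N f"
begin

lemma f_cong:
  "[i = i'] (mod int N) \<Longrightarrow> [j = j'] (mod int N) \<Longrightarrow> \<tau> \<in> uhp \<Longrightarrow> f i j \<tau> = f i' j' \<tau>"
  using f_M_Ell unfolding function_on_M_Ell_def by blast

lemma f_mod: "\<tau> \<in> uhp \<Longrightarrow> f i j \<tau> = f (i mod int N) (j mod int N) \<tau>"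
  by (rule f_cong) auto

lemma f_holomorphic: "f i j holomorphic_on uhp"
  using f_M_Ell unfolding function_on_M_Ell_def by blast

lemma f_SL2:
  "a * d - b * c = 1 \<Longrightarrow> \<tau> \<in> uhp \<Longrightarrow>
    f i j ((of_int a * \<tau> + of_int b) / (of_int c * \<tau> + of_int d)) = f (a * i + c * j) (b * i + d * j) \<tau>"
  using f_M_Ell unfolding function_on_M_Ell_def by blast

lemma f_translate: "\<tau> \<in> uhp \<Longrightarrow> f i j (\<tau> + of_int r) = f i (r * i + j) \<tau>"
  using f_SL2[of 1 1 r 0 \<tau> i j] by simp

lemma f_invert: "\<tau> \<in> uhp \<Longrightarrow> f i j (- 1 / \<tau>) = f j (- i) \<tau>"
  using f_SL2[of 0 0 "-1" 1 \<tau> i j] by simp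

text \<open>
  For $n = N + 1$ the relation $n T_n f = \Phi(f)$ expresses $f(g^i, g^j, n \tau)$ through
  $\Phi(f(g^i, g^j, \tau))$ and values of $f$ at points of imaginary part at most $n \Im \tau / 4$.
  As $\deg \Phi = n$, induction on the imaginary part gives exponential growth.
\<close>

lemma growth_infinity:
  obtains A where "A \<ge> 0" "\<And>i j \<tau>. Im \<tau> \<ge> 1 / 2 \<Longrightarrow> norm (f i j \<tau>) \<le> exp (A * Im \<tau>)"
proof -
  define n where "n = N + 1"
  have n: "n \<ge> 2" "n > 0" using N_pos by (auto simp: n_def)
  have "\<exists>\<Phi>. degree \<Phi> = n \<and> (\<forall>\<tau>\<in>uhp. nT n f i j \<tau> = poly \<Phi> (f i j \<tau>))" for i j
    using f_Hecke_monic n(2) SL2_orbit_self[of i j N] unfolding Hecke_monic_def by blast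
  then obtain \<Phi> where \<Phi>: "\<And>i j. degree (\<Phi> i j) = n"
      "\<And>i j \<tau>. \<tau> \<in> uhp \<Longrightarrow> nT n f i j \<tau> = poly (\<Phi> i j) (f i j \<tau>)"
    by metis
  have "\<exists>C\<ge>1. \<forall>z. norm (poly (\<Phi> i j) z) \<le> C * max 1 (norm z) ^ n" for i j
    using poly_norm_bound[of "\<Phi> i j"] unfolding \<Phi>(1) by metis
  then obtain C where C: "\<And>i j. C i j \<ge> 1"
      "\<And>i j z. norm (poly (\<Phi> i j) z) \<le> C i j * max 1 (norm z) ^ n"
    by metis
  \<comment> \<open>Finitely many pairs of residues represent all values of f, which makes the
    constants below uniform in i and j.\<close>
  define I where "I = {0..<int N} \<times> {0..<int N}"
  have I: "finite I" "(0, 0) \<in> I" using N_pos by (auto simp: I_def)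
  have I_mod: "(i mod int N, j mod int N) \<in> I" for i j
    using N_pos by (simp add: I_def)
  define C0 where "C0 = (\<Sum>(i,j)\<in>I. C i j)"
  have C0: "C i j \<le> C0" if "(i, j) \<in> I" for i j
    unfolding C0_def using member_le_sum[OF that, of "\<lambda>(i, j). C i j"] I C(1)
    by (fastforce intro: order_trans[of 0 1])
  have C0_1: "C0 \<ge> 1" using C0[OF I(2)] C(1)[of 0 0] by simp
  \<comment> \<open>Above this height, all points Im \<tau> / d^2 with d dividing n still lie above
    1/2, the lower end of the range of the induction.\<close>
  define Y where "Y = real n ^ 2 / 2"
  have Y: "Y \<ge> 2" using power_mono[of 2 "real n" 2] n by (simp add: Y_def)
  define R where "R = cbox (Complex 0 (1/2)) (Complex 1 Y)"
  have R: "R \<subseteq> uhp" by (auto simp: R_def uhp_def in_cbox_complex_iff)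
  have "\<exists>M\<ge>1. \<forall>\<tau>\<in>R. norm (f i j \<tau>) \<le> M" for i j
  proof -
    have "continuous_on R (f i j)"
      using holomorphic_on_imp_continuous_on[OF f_holomorphic] R continuous_on_subset by blast
    then have "bounded (f i j ` R)"
      by (intro compact_imp_bounded compact_continuous_image) (auto simp: R_def)
    then obtain M where "\<forall>x\<in>f i j ` R. norm x \<le> M" unfolding bounded_iff by blast
    then show ?thesis by (intro exI[of _ "max 1 M"]) auto
  qed
  then obtain M where M: "\<And>i j. M i j \<ge> 1" "\<And>i j \<tau>. \<tau> \<in> R \<Longrightarrow> norm (f i j \<tau>) \<le> M i j"
    by metis
  define M0 where "M0 = (\<Sum>(i,j)\<in>I. M i j)"
  have M0: "M i j \<le> M0" if "(i, j) \<in> I" for i j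
    unfolding M0_def using member_le_sum[OF that, of "\<lambda>(i, j). M i j"] I M(1)
    by (fastforce intro: order_trans[of 0 1])
  have M0_1: "M0 \<ge> 1" using M0[OF I(2)] M(1)[of 0 0] by simp
  define D where "D = (\<Sum>d\<in>{d. d dvd n} - {1}. real d)"
  have D: "D \<ge> 1"
  proof -
    have "real n \<le> D"
      unfolding D_def using n by (intro member_le_sum) auto
    then show ?thesis using n by linarith
  qed
  \<comment> \<open>The slack e^(-B) in the induction hypothesis absorbs the constant of \<Phi>: its
    n-th power with n \<ge> 2 gives C0 e^(-nB) \<le> C0 e^(-2B) = e^(-B) / 2.\<close>
  define B where "B = ln (2 * C0)"
  \<comment> \<open>At height at least 1/2 the first two summands give A Im \<tau> - B \<ge> ln M0,
    which is the base case; the third absorbs the terms with d > 1 into the other half of the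
    bound.\<close>
  define A where "A = 2 * B + 2 * ln M0 + ln (2 * D)"
  have nonneg: "B \<ge> 0" "ln M0 \<ge> 0" "ln (2 * D) \<ge> 0"
    using C0_1 M0_1 D by (auto simp: B_def)
  then have A: "A \<ge> 0" by (simp add: A_def)
  have base: "norm (f i j \<tau>) \<le> exp (A * Im \<tau> - B)" if \<tau>: "1 / 2 \<le> Im \<tau>" "Im \<tau> \<le> Y" for i j \<tau>
  proof -
    define r where "r = \<lfloor>Re \<tau>\<rfloor>"
    define \<tau>' where "\<tau>' = \<tau> - of_int r"
    have Re: "0 \<le> Re \<tau>'" "Re \<tau>' \<le> 1" unfolding \<tau>'_def r_def by simp_all linarith+
    have R': "\<tau>' \<in> R"
      using Re \<tau> by (simp add: R_def in_cbox_complex_iff \<tau>'_def)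
    then have uhp: "\<tau>' \<in> uhp" using R by auto
    have "f i j \<tau> = f (i mod int N) ((r * i + j) mod int N) \<tau>'"
      using f_translate[OF uhp, of i j r] f_mod[OF uhp] by (simp add: \<tau>'_def)
    also have "norm \<dots> \<le> M0"
      using M(2)[OF R'] M0[OF I_mod] order_trans by blast
    also have "\<dots> = exp (ln M0)" using M0_1 by simp
    also have "ln M0 \<le> A * Im \<tau> - B"
      using mult_left_mono[OF \<tau>(1) A] nonneg by (simp add: A_def)
    finally show ?thesis by simp
  qed
  have main: "norm (f i j \<tau>) \<le> exp (A * Im \<tau> - B)" if "1 / 2 \<le> Im \<tau>" "Im \<tau> \<le> 2 ^ k" for i j \<tau> k
    using that
  proof (induction k arbitrary: i j \<tau>)
    case 0
    then show ?case using Y by (intro base) auto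
  next
    case (Suc k)
    show ?case
    proof (cases "Im \<tau> \<le> Y")
      case True
      then show ?thesis using Suc.prems by (intro base)
    next
      case False
      define y where "y = Im \<tau>"
      have y: "y > Y" "y \<ge> 2" "y \<le> 2 * 2 ^ k" using False Y Suc.prems by (auto simp: y_def)
      define \<tau>' where "\<tau>' = \<tau> / of_nat n"
      have uhp: "\<tau> \<in> uhp" "\<tau>' \<in> uhp" using y n by (auto simp: uhp_def y_def \<tau>'_def)
      define i0 where "i0 = i mod int N"
      define j0 where "j0 = j mod int N"
      have ij: "(i0, j0) \<in> I" unfolding i0_def j0_def by (rule I_mod)
      define E where "E d = (\<Sum>b<d. f (int d * i0) (int (n div d) * j0 - int b * i0)
                         ((of_nat (n div d) * \<tau>' + of_nat b) / of_nat d))" for d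
      have E1: "E 1 = f i j \<tau>"
      proof -
        have "E 1 = f i0 (int n * j0) \<tau>" using n by (simp add: E_def \<tau>'_def)
        \<comment> \<open>Here n = N + 1 matters: n is congruent to 1 modulo N, so the term d = 1 is
          f at the original pair.\<close>
        also have "\<dots> = f i j \<tau>"
          using uhp(1) by (intro f_cong) (auto simp: i0_def j0_def n_def cong_def ring_distribs mod_simps)
        finally show ?thesis .
      qed
      have E: "norm (E d) \<le> real d * exp (A * y / 4 - B)" if d: "d dvd n" "d \<noteq> 1" for d
      proof -
        have d0: "d > 0" "d \<ge> 2" using d n by (auto intro: Nat.gr0I) (metis One_nat_def Suc_1 Suc_leI dvd_pos_nat less_one linorder_neqE_nat not_less_eq)
        have "norm (E d) \<le> (\<Sum>b<d. exp (A * y / 4 - B))"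
          unfolding E_def
        proof (rule sum_norm_le)
          fix b
          define z where "z = (of_nat (n div d) * \<tau>' + of_nat b) / (of_nat d :: complex)"
          have "Im z = real (n div d) * (y / real n) / real d"
            by (simp add: z_def \<tau>'_def y_def)
          also have "\<dots> = y / real d ^ 2"
            using d(1) d0 n by (simp add: real_of_nat_div power2_eq_square field_simps)
          finally have Imz: "Im z = y / real d ^ 2" .
          have "real d ^ 2 \<le> real n ^ 2"
            using d(1) n by (intro power_mono) (auto dest: dvd_imp_le)
          also have "\<dots> \<le> 2 * y" using y by (simp add: Y_def)
          finally have "1 / 2 \<le> Im z"
            using d0 unfolding Imz by (simp add: field_simps)
          moreover have d4: "real d ^ 2 \<ge> 4" using power_mono[of 2 "real d" 2] d0 by simp
          then have Imz4: "Im z \<le> y / 4"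
            unfolding Imz using y d0 by (intro divide_left_mono) auto
          moreover have "Im z \<le> 2 ^ k" using Imz4 y by simp
          ultimately have "norm (f i' j' z) \<le> exp (A * Im z - B)" for i' j'
            using Suc.IH by blast
          moreover have "A * Im z \<le> A * y / 4" using mult_left_mono[OF Imz4 A] by simp
          ultimately show "norm (f (int d * i0) (int (n div d) * j0 - int b * i0) z) \<le> exp (A * y / 4 - B)"
            by (meson diff_right_mono exp_le_cancel_iff order_trans)
        qed
        then show ?thesis by simp
      qed
      have "nT n f i0 j0 \<tau>' = (\<Sum>d | d dvd n. E d)"
        unfolding E_def using n by (intro nT_conv_divisors)
      also have "\<dots> = E 1 + (\<Sum>d\<in>{d. d dvd n} - {1}. E d)"
        using n by (intro sum.remove) auto
      finally have "f i j \<tau> = nT n f i0 j0 \<tau>' - (\<Sum>d\<in>{d. d dvd n} - {1}. E d)"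
        using E1 by simp
      also have "norm \<dots> \<le> norm (nT n f i0 j0 \<tau>') + norm (\<Sum>d\<in>{d. d dvd n} - {1}. E d)"
        by (rule norm_triangle_ineq4)
      also have "norm (\<Sum>d\<in>{d. d dvd n} - {1}. E d) \<le> (\<Sum>d\<in>{d. d dvd n} - {1}. real d * exp (A * y / 4 - B))"
        using E by (intro sum_norm_le) auto
      also have "\<dots> = D * exp (A * y / 4 - B)" by (simp add: D_def sum_distrib_right)
      also have "\<dots> \<le> exp (A * y - B) / 2"
      proof -
        have "A * 1 \<le> A * (3 * y / 4)" using y A by (intro mult_left_mono) auto
        moreover have "ln (2 * D) \<le> A" using nonneg by (simp add: A_def)
        ultimately have "ln (2 * D) + (A * y / 4 - B) \<le> A * y - B" by simp
        then have "exp (ln (2 * D)) * exp (A * y / 4 - B) \<le> exp (A * y - B)"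
          by (simp flip: exp_add)
        then show ?thesis using D by simp
      qed
      also have "norm (nT n f i0 j0 \<tau>') \<le> exp (A * y - B) / 2"
      proof -
        have "1 / 2 \<le> y / real n" "y / real n \<le> 2 ^ k"
        proof -
          have "real n * 1 \<le> real n * real n" using n by (intro mult_left_mono) auto
          then have "real n \<le> 2 * y" using y by (simp add: Y_def power2_eq_square)
          then show "1 / 2 \<le> y / real n" using n by (simp add: field_simps)
          have "y / real n \<le> y / 2" using y n by (intro divide_left_mono) auto
          then show "y / real n \<le> 2 ^ k" using y by linarith
        qed
        then have IH: "norm (f i0 j0 \<tau>') \<le> exp (A * (y / real n) - B)"
          using Suc.IH[of \<tau>' i0 j0] by (simp add: \<tau>'_def y_def)
        \<comment> \<open>The bound for f at \<open>\<tau>'\<close> is at least 1, so it also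
          dominates the maximum with 1 in the polynomial estimate.\<close>
        have "A * (1/2) \<le> A * (y / real n)"
          using \<open>1 / 2 \<le> y / real n\<close> A by (rule mult_left_mono)
        moreover have "B \<le> A * (1/2)" using nonneg by (simp add: A_def)
        ultimately have ge1: "1 \<le> exp (A * (y / real n) - B)"
          by (subst one_le_exp_iff) linarith
        have "norm (nT n f i0 j0 \<tau>') \<le> C i0 j0 * max 1 (norm (f i0 j0 \<tau>')) ^ n"
          using \<Phi>(2)[OF uhp(2)] C(2) by simp
        also have "\<dots> \<le> C0 * exp (A * (y / real n) - B) ^ n"
          using C0[OF ij] C0_1 IH ge1 by (intro mult_mono power_mono) auto
        also have "exp (A * (y / real n) - B) ^ n = exp (A * y - real n * B)"
          using n by (simp add: right_diff_distrib flip: exp_of_nat_mult)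
        also have "C0 * exp (A * y - real n * B) \<le> C0 * exp (A * y - 2 * B)"
        proof -
          have "2 * B \<le> real n * B" using n nonneg by (intro mult_right_mono) auto
          then show ?thesis using C0_1 by simp
        qed
        also have "\<dots> = exp (A * y - B) / 2"
          using C0_1 by (simp add: B_def exp_diff exp_double exp_add field_simps power2_eq_square)
        finally show ?thesis .
      qed
      finally show ?thesis by (simp add: y_def)
    qed
  qed
  have "norm (f i j \<tau>) \<le> exp (A * Im \<tau>)" if "Im \<tau> \<ge> 1 / 2" for i j \<tau>
  proof -
    obtain k where "Im \<tau> < 2 ^ k" using real_arch_pow[of 2 "Im \<tau>"] by auto
    then have "norm (f i j \<tau>) \<le> exp (A * Im \<tau> - B)" using that by (intro main[where k = k]) auto
    also have "\<dots> \<le> exp (A * Im \<tau>)" using nonneg by simp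
    finally show ?thesis .
  qed
  with A show ?thesis by (rule that)
qed

text \<open>Translate to |Re \<tau>| \<le> 1/2 and invert. For height y < 1/2 then |\<tau>|^2 \<le>
  1/2, so the inversion at least doubles the height but keeps it at most 1/y. Iteration reaches
  height 1/2, and the bound e^(A/y) carries back through each step.\<close>

lemma growth_real_axis:
  assumes A: "A \<ge> 0" "\<And>i j \<tau>. Im \<tau> \<ge> 1 / 2 \<Longrightarrow> norm (f i j \<tau>) \<le> exp (A * Im \<tau>)"
    and \<tau>: "Im \<tau> > 0" "Im \<tau> < 1 / 2"
  shows "norm (f i j \<tau>) \<le> exp (A / Im \<tau>)"
proof -
  have "norm (f i j \<tau>) \<le> exp (A / Im \<tau>)" if "(1 / 2) ^ k \<le> Im \<tau>" "Im \<tau> < 1 / 2" for k i j \<tau>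
    using that
  proof (induction k arbitrary: i j \<tau>)
    case (Suc k)
    define y where "y = Im \<tau>"
    have y: "y > 0" "y < 1 / 2" using Suc.prems by (auto simp: y_def intro: less_le_trans[of 0 "(1/2) ^ Suc k"])
    define r where "r = round (Re \<tau>)"
    define \<tau>' where "\<tau>' = \<tau> - of_int r"
    define z where "z = - 1 / \<tau>'"
    have \<tau>': "Im \<tau>' = y" "\<bar>Re \<tau>'\<bar> \<le> 1 / 2" "\<tau>' \<noteq> 0"
      using of_int_round_abs_le[of "Re \<tau>"] y
      by (auto simp: \<tau>'_def y_def r_def abs_minus_commute complex_eq_iff)
    define s where "s = (Re \<tau>')\<^sup>2 + y\<^sup>2"
    have s: "y\<^sup>2 \<le> s" "s \<le> 1 / 2" "s > 0"
    proof -
      have "(Re \<tau>')\<^sup>2 \<le> (1/2)\<^sup>2" using \<tau>' by (intro abs_le_square_iff[THEN iffD1]) auto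
      moreover have "y\<^sup>2 \<le> (1/2)\<^sup>2" using y by (intro power_mono) auto
      ultimately show "s \<le> 1 / 2" by (simp add: s_def power2_eq_square)
    qed (use y in \<open>auto simp: s_def add_nonneg_pos\<close>)
    have Imz: "Im z = y / s"
      by (simp add: z_def Im_divide \<tau>' s_def)
    have z_ge: "Im z \<ge> 2 * y" unfolding Imz using s y by (simp add: field_simps)
    have z_le: "Im z \<le> 1 / y"
      unfolding Imz using s y by (simp add: field_simps power2_eq_square)
    have uhp: "\<tau>' \<in> uhp" "z \<in> uhp" using y \<tau>' z_ge by (auto simp: uhp_def)
    have "f i j \<tau> = f i (r * i + j) \<tau>'"
      using f_translate[OF uhp(1), of i j r] by (simp add: \<tau>'_def)
    also have "\<tau>' = - 1 / z" using \<tau>' by (simp add: z_def)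
    also have "f i (r * i + j) (- 1 / z) = f (r * i + j) (- i) z"
      by (rule f_invert[OF uhp(2)])
    also have "norm \<dots> \<le> exp (A / y)"
    proof (cases "Im z \<ge> 1 / 2")
      case True
      then have "norm (f (r * i + j) (- i) z) \<le> exp (A * Im z)" by (rule A)
      also have "A * Im z \<le> A * (1 / y)" using z_le A(1) by (rule mult_left_mono)
      finally show ?thesis by simp
    next
      case False
      have "(1 / 2) ^ k \<le> Im z" using z_ge Suc.prems by (simp add: y_def)
      then have "norm (f (r * i + j) (- i) z) \<le> exp (A / Im z)" using False by (intro Suc.IH) auto
      also have "A / Im z \<le> A / y" using z_ge y A(1) by (intro divide_left_mono) auto
      finally show ?thesis by simp
    qed
    finally show ?case by (simp add: y_def)
  qed auto
  moreover obtain k where "(1 / 2) ^ k < Im \<tau>"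
    using real_arch_pow_inv[of "Im \<tau>" "1 / 2"] \<tau> by auto
  ultimately show ?thesis using \<tau>(2) less_imp_le by blast
qed

text \<open>Heights at least 1 serve for the existence of expansions and the vanishing of
  coefficients; height 1/m is where the exponents with first index m are estimated.\<close>

lemma growth:
  "\<exists>A\<ge>0. (\<forall>i j \<tau>. Im \<tau> \<ge> 1 \<longrightarrow> norm (f i j \<tau>) \<le> exp (A * Im \<tau>)) \<and>
    (\<forall>i j \<tau> m. m > 0 \<longrightarrow> Im \<tau> = 1 / real m \<longrightarrow> norm (f i j \<tau>) \<le> exp (A * real m))"
proof -
  obtain A where A: "A \<ge> 0" "\<And>i j \<tau>. Im \<tau> \<ge> 1 / 2 \<Longrightarrow> norm (f i j \<tau>) \<le> exp (A * Im \<tau>)"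
    using growth_infinity by blast
  have "norm (f i j \<tau>) \<le> exp (A * real m)" if "m > 0" "Im \<tau> = 1 / real m" for i j \<tau> m
  proof (cases "Im \<tau> < 1 / 2")
    case True
    then show ?thesis using growth_real_axis[OF A, of \<tau> i j] that by simp
  next
    case False
    then have "norm (f i j \<tau>) \<le> exp (A * Im \<tau>)" by (intro A) auto
    also have "A * Im \<tau> \<le> A * real m"
    proof (rule mult_left_mono[OF _ A(1)])
      have "1 / real m \<le> 1" "1 \<le> real m" using that(1) by simp_all
      then show "Im \<tau> \<le> real m" using that(2) by linarith
    qed
    finally show ?thesis by simp
  qed
  then show ?thesis by (intro exI[of _ A] conjI allI impI A) auto
qed

end

subsection \<open>The exponents of the product\<close>

lemma sum_e2pi_multiples_int:
  assumes "M > 0"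
  shows "(\<Sum>k\<in>{0..<int M}. e2pi (of_int k * (of_int r / of_nat M))) = (if int M dvd r then of_nat M else 0)"
proof -
  have "{0..<int M} = int ` {..<M}" using image_atLeastZeroLessThan_int[of "int M"] by simp
  then show ?thesis
    using sum_e2pi_multiples[OF assms, of r] by (simp add: sum.reindex)
qed

lemma summable_on_product_nonneg:
  fixes f :: "'a \<Rightarrow> real" and g :: "'b \<Rightarrow> real"
  assumes "f summable_on A" "g summable_on B" "\<And>x. x \<in> A \<Longrightarrow> f x \<ge> 0" "\<And>y. y \<in> B \<Longrightarrow> g y \<ge> 0"
  shows "(\<lambda>(x, y). f x * g y) summable_on A \<times> B"
proof (rule summable_on_SigmaI)
  show "((\<lambda>y. (case (x, y) of (x, y) \<Rightarrow> f x * g y)) has_sum f x * infsum g B) B" for x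
    using has_sum_cmult_right[OF has_sum_infsum[OF assms(2)]] by simp
  show "(\<lambda>x. f x * infsum g B) summable_on A"
    using assms(1) by (rule summable_on_cmult_left)
qed (use assms in auto)

section \<open>The Fourier transform \<open>vv\<close>, its expansions, and convergence of the log
  series\<close>

context hecke_monic_function
begin

text \<open>Fourier inversion on Z/N.\<close>

lemma f_eq_sum_vv:
  assumes "\<tau> \<in> uhp"
  shows "f i j \<tau> = (\<Sum>k\<in>{0..<int N}. e2pi (of_int (j * k) / of_nat N) * vv N f i k \<tau>)"
proof -
  have "(\<Sum>k\<in>{0..<int N}. e2pi (of_int (j * k) / of_nat N) * vv N f i k \<tau>) =
     (\<Sum>k\<in>{0..<int N}. \<Sum>j'\<in>{0..<int N}. 1 / of_nat N * f i j' \<tau> * e2pi (of_int k * (of_int (j - j') / of_nat N)))"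
  proof (rule sum.cong [OF refl])
    fix k
    have "e2pi (of_int (j * k) / of_nat N) * e2pi (- of_int (j' * k) / of_nat N) =
        e2pi (of_int k * (of_int (j - j') / of_nat N))" for j'
    proof -
      have "of_int (j * k) / of_nat N + - of_int (j' * k) / of_nat N =
          of_int k * (of_int (j - j') / of_nat N :: complex)"
        using N_pos by (simp add: field_simps)
      then show ?thesis by (simp only: flip: e2pi_add)
    qed
    then show "e2pi (of_int (j * k) / of_nat N) * vv N f i k \<tau> =
        (\<Sum>j'\<in>{0..<int N}. 1 / of_nat N * f i j' \<tau> * e2pi (of_int k * (of_int (j - j') / of_nat N)))"
      unfolding vv_def sum_distrib_left by (intro sum.cong refl) (metis mult.assoc mult.commute)
  qed
  also have "\<dots> = (\<Sum>j'\<in>{0..<int N}. 1 / of_nat N * f i j' \<tau> * (if int N dvd j - j' then of_nat N else 0))"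
    by (subst sum.swap) (simp only: sum_e2pi_multiples_int[OF N_pos] flip: sum_distrib_left)
  also have "\<dots> = (\<Sum>j'\<in>{j mod int N}. 1 / of_nat N * f i j' \<tau> * (if int N dvd j - j' then of_nat N else 0))"
    using N_pos by (intro sum.mono_neutral_right) (auto simp: mod_eq_dvd_iff [symmetric])
  also have "\<dots> = f i (j mod int N) \<tau>" using N_pos by (simp add: minus_mod_eq_mult_div)
  also have "\<dots> = f i j \<tau>" using assms by (intro f_cong) auto
  finally show ?thesis ..
qed

lemma vv_cong: "vv N f i (k + int N * s) = vv N f i k"
proof
  fix \<tau>
  have "e2pi (- of_int (j * (k + int N * s)) / of_nat N) = e2pi (- of_int (j * k) / of_nat N)" for j
  proof -
    have "- of_int (j * (k + int N * s)) / of_nat N = - of_int (j * k) / of_nat N + (of_int (- (j * s)) :: complex)"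
      using N_pos by (simp add: field_simps)
    then show ?thesis by (simp only: e2pi_add e2pi_of_int mult_1_right)
  qed
  then show "vv N f i (k + int N * s) \<tau> = vv N f i k \<tau>" by (simp add: vv_def)
qed

text \<open>Translation replaces j by i + j, and the Fourier transform turns this shift into
  multiplication by a character value. It determines the exponents modulo Z.\<close>

lemma vv_translate:
  assumes "\<tau> \<in> uhp"
  shows "vv N f i k (\<tau> + 1) = e2pi (of_int (i * k) / of_nat N) * vv N f i k \<tau>"
proof -
  have "(\<Sum>j\<in>{0..<int N}. e2pi (- of_int (j * k) / of_nat N) * f i (i + j) \<tau>) =
    (\<Sum>j\<in>{0..<int N}. e2pi (of_int (i * k) / of_nat N) * (e2pi (- of_int (j * k) / of_nat N) * f i j \<tau>))"
  proof (rule sum.reindex_bij_witness[of _ "\<lambda>j. (j - i) mod int N" "\<lambda>j. (i + j) mod int N"])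
    fix j
    define m where "m = (i + j) div int N"
    have m: "i + j = int N * m + (i + j) mod int N" by (simp add: m_def)
    have "of_int (i * k) / of_nat N + - of_int (((i + j) mod int N) * k) / of_nat N =
      - of_int (j * k) / of_nat N + (of_int (m * k) :: complex)"
    proof -
      have "(i + j) mod int N = i + j - int N * m" using m by linarith
      then have "(i + j) mod int N * k = i * k + j * k - int N * (m * k)"
        by (simp only: left_diff_distrib distrib_right mult.assoc)
      then show ?thesis using N_pos by (simp only:) (simp add: field_simps)
    qed
    from arg_cong[of _ _ e2pi, OF this]
    have "e2pi (of_int (i * k) / of_nat N) * e2pi (- of_int (((i + j) mod int N) * k) / of_nat N) =
      e2pi (- of_int (j * k) / of_nat N)"
      by (simp only: e2pi_add e2pi_of_int mult_1_right)
    moreover have "f i ((i + j) mod int N) \<tau> = f i (i + j) \<tau>"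
      using assms by (intro f_cong) auto
    ultimately show "e2pi (of_int (i * k) / of_nat N) *
         (e2pi (- of_int ((i + j) mod int N * k) / of_nat N) * f i ((i + j) mod int N) \<tau>) =
        e2pi (- of_int (j * k) / of_nat N) * f i (i + j) \<tau>"
      by (simp only: mult.assoc [symmetric])
  qed (use N_pos in \<open>auto simp: mod_simps\<close>)
  then show ?thesis
    using f_translate[OF assms, of i _ 1] by (simp add: vv_def sum_distrib_left mult_ac)
qed

lemma vv_holomorphic: "vv N f i k holomorphic_on uhp"
  unfolding vv_def by (intro holomorphic_intros f_holomorphic)

lemma vv_norm_bound:
  assumes "\<And>j. norm (f i j \<tau>) \<le> B"
  shows "norm (vv N f i k \<tau>) \<le> B"
proof -
  have "norm (\<Sum>j\<in>{0..<int N}. e2pi (- of_int (j * k) / of_nat N) * f i j \<tau>) \<le> (\<Sum>j\<in>{0..<int N}. B)"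
    by (rule sum_norm_le) (simp add: norm_mult norm_e2pi assms flip: of_int_mult)
  then show ?thesis using N_pos by (simp add: vv_def norm_divide field_simps)
qed

text \<open>The twist removes the fractional part of the exponents of \<open>vv N f i k\<close>, which lie in $ik/N + Z$.\<close>

definition vv_twist :: "int \<Rightarrow> int \<Rightarrow> complex \<Rightarrow> complex" where
  "vv_twist i k \<tau> = vv N f i k \<tau> * e2pi (- (of_int (i * k) / of_nat N * \<tau>))"

lemma vv_twist_norm_bound:
  assumes "\<And>j. norm (f i j \<tau>) \<le> B"
  shows "norm (vv_twist i k \<tau>) \<le> B * exp (2 * pi * of_int (i * k) / real N * Im \<tau>)"
proof -
  have "Im (of_int (i * k) / of_nat N * \<tau>) = of_int (i * k) / real N * Im \<tau>"
    by (simp flip: of_int_mult)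
  then have "norm (e2pi (- (of_int (i * k) / of_nat N * \<tau>))) = exp (2 * pi * of_int (i * k) / real N * Im \<tau>)"
    by (simp add: norm_e2pi)
  then show ?thesis
    using vv_norm_bound[OF assms, of k] by (simp only: vv_twist_def norm_mult mult_right_mono exp_ge_zero)
qed

definition twist_coeff :: "int \<Rightarrow> int \<Rightarrow> int \<Rightarrow> complex" where
  "twist_coeff i k = q_coeff 1 (vv_twist i k)"

lemma vv_twist_expansion: "has_q_expansion 1 (vv_twist i k) (twist_coeff i k)"
proof -
  obtain A where A: "A \<ge> 0" "\<And>i j \<tau>. Im \<tau> \<ge> 1 \<Longrightarrow> norm (f i j \<tau>) \<le> exp (A * Im \<tau>)"
    "\<And>i j \<tau> m. m > 0 \<Longrightarrow> Im \<tau> = 1 / real m \<Longrightarrow> norm (f i j \<tau>) \<le> exp (A * real m)"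
    using growth by blast
  have "vv_twist i k holomorphic_on uhp"
    unfolding vv_twist_def by (intro holomorphic_intros vv_holomorphic)
  moreover have "vv_twist i k (\<tau> + 1) = vv_twist i k \<tau>" if "\<tau> \<in> uhp" for \<tau>
  proof -
    define c :: complex where "c = of_int (i * k) / of_nat N"
    have "- (c * (\<tau> + 1)) = - (c * \<tau>) + - c" by (simp add: distrib_left)
    then have "e2pi (- (c * (\<tau> + 1))) = e2pi (- (c * \<tau>)) * inverse (e2pi c)"
      by (simp only: e2pi_add e2pi_minus[of c])
    then show ?thesis
      using vv_translate[OF that, of i k] unfolding vv_twist_def c_def [symmetric] by simp
  qed
  moreover have "norm (vv_twist i k \<tau>) \<le> 1 * exp ((A + 2 * pi * of_int (i * k) / real N) * Im \<tau>)"
    if "Im \<tau> \<ge> 1" for \<tau>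
    using vv_twist_norm_bound[OF A(2)[OF that], where k = k] by (simp add: distrib_right exp_add)
  ultimately obtain c where "has_q_expansion 1 (vv_twist i k) c"
    by (rule has_q_expansion_exists)
  then show ?thesis using q_coeff_eq[of 1] by (simp add: twist_coeff_def)
qed

lemma q_coeff_vv: "q_coeff N (vv N f i k) (i * k + int N * s) = twist_coeff i k s"
proof -
  define c where "c l = (if int N dvd l - i * k then twist_coeff i k ((l - i * k) div int N) else 0)" for l
  have "has_q_expansion N (vv N f i k) c"
    unfolding has_q_expansion_def
  proof
    fix \<tau> assume \<tau>: "\<tau> \<in> uhp"
    define e where "e = e2pi (of_int (i * k) / of_nat N * \<tau>)"
    have "((\<lambda>s. e * (twist_coeff i k s * e2pi (of_int s * \<tau>))) has_sum e * vv_twist i k \<tau>) UNIV"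
      using vv_twist_expansion \<tau> by (intro has_sum_cmult_right) (auto simp: has_q_expansion_def)
    also have "e * vv_twist i k \<tau> = vv N f i k \<tau>"
      by (simp add: vv_twist_def e_def e2pi_minus)
    also have "((\<lambda>s. e * (twist_coeff i k s * e2pi (of_int s * \<tau>))) has_sum vv N f i k \<tau>) UNIV \<longleftrightarrow>
      ((\<lambda>l. c l * e2pi (of_int l * \<tau> / of_nat N)) has_sum vv N f i k \<tau>) {l. int N dvd l - i * k}"
    proof (rule has_sum_reindex_bij_witness[of _ "\<lambda>l. (l - i * k) div int N" "\<lambda>s. i * k + int N * s"])
      fix s
      have "of_int (i * k + int N * s) * \<tau> / of_nat N = of_int (i * k) / of_nat N * \<tau> + of_int s * \<tau>"
        using N_pos by (simp add: field_simps)
      then show "c (i * k + int N * s) * e2pi (of_int (i * k + int N * s) * \<tau> / of_nat N) =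
          e * (twist_coeff i k s * e2pi (of_int s * \<tau>))"
        using N_pos by (simp only: e2pi_add) (simp add: c_def e_def)
    qed (use N_pos in auto)
    also have "\<dots> \<longleftrightarrow> ((\<lambda>l. c l * e2pi (of_int l * \<tau> / of_nat N)) has_sum vv N f i k \<tau>) UNIV"
      by (rule has_sum_cong_neutral) (auto simp: c_def)
    finally show "((\<lambda>l. c l * e2pi (of_int l * \<tau> / of_nat N)) has_sum vv N f i k \<tau>) UNIV" .
  qed
  from q_coeff_eq[OF N_pos this] show ?thesis using N_pos by (simp add: c_def)
qed

text \<open>The residue of k modulo N selects the function and s only the coefficient. So one
  residue class of exponents is read off a single expansion, at the multiples of m that Hecke
  averaging retains.\<close>

lemma prod_exponent_eq_twist_coeff:
  "prod_exponent N f m (k + int N * s) = twist_coeff (int m) k (int m * s)"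
proof -
  have "int m * (k + int N * s) = int m * k + int N * (int m * s)" by (simp add: algebra_simps)
  then show ?thesis by (simp only: prod_exponent_def vv_cong q_coeff_vv)
qed

lemma prod_exponent_bound:
  assumes "y > 0" "\<And>i j \<tau>. Im \<tau> = y \<Longrightarrow> norm (f i j \<tau>) \<le> B"
  shows "norm (prod_exponent N f m k) \<le> B * exp (2 * pi * (of_int (int m * k) / real N * y))"
proof -
  have "norm (vv_twist (int m) k \<tau>) \<le> B * exp (2 * pi * of_int (int m * k) / real N * y)"
    if "Im \<tau> = y" for \<tau>
    using vv_twist_norm_bound[OF assms(2)[OF that], where i = "int m" and k = k] that by simp
  \<comment> \<open>Twisting by k itself removes the whole exponent mk/N, so
    \<open>prod_exponent\<close> becomes a constant term.\<close>
  from q_expansion_coeff_bound[OF vv_twist_expansion assms(1) this, of 0]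
  show ?thesis
    using prod_exponent_eq_twist_coeff[of m k 0] by (simp add: mult.assoc)
qed

text \<open>At height y \<ge> 1 the coefficient is bounded by e^((A + 2 pi mk/N) y). For L \<ge> AN
  and k < -L this tends to 0 as y grows. One L for all m is what the convergence estimate
  needs.\<close>

lemma prod_exponent_eq_0:
  "\<exists>L :: nat. \<forall>m > 0. \<forall>k < - int L. prod_exponent N f m k = 0"
proof -
  obtain A where A: "A \<ge> 0" "\<And>i j \<tau>. Im \<tau> \<ge> 1 \<Longrightarrow> norm (f i j \<tau>) \<le> exp (A * Im \<tau>)"
    "\<And>i j \<tau> m. m > 0 \<Longrightarrow> Im \<tau> = 1 / real m \<Longrightarrow> norm (f i j \<tau>) \<le> exp (A * real m)"
    using growth by blast
  obtain L :: nat where L: "A * real N \<le> real L" using real_arch_simple by blast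
  have "prod_exponent N f m k = 0" if m: "m > 0" and k: "k < - int L" for m k
  proof -
    define E where "E = A + 2 * pi * (of_int (int m * k) / real N)"
    have "int m * k \<le> 1 * k" using m k by (intro mult_right_mono_neg) auto
    then have "real_of_int (int m * k) < - real L" using k by linarith
    then have "of_int (int m * k) / real N < - A"
      using L N_pos by (simp add: field_simps)
    then have "2 * pi * (of_int (int m * k) / real N) < 2 * pi * (- A)" by (intro mult_strict_left_mono) auto
    also have "2 * pi * (- A) \<le> 1 * (- A)"
      using A(1) pi_gt3 by (intro mult_right_mono_neg) auto
    finally have E: "E < 0" by (simp add: E_def)
    have "eventually (\<lambda>y. norm (prod_exponent N f m k) \<le> exp (E * y)) at_top"
      using eventually_ge_at_top[of 1]
    proof eventually_elim
      case (elim y)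
      have "norm (prod_exponent N f m k) \<le> exp (A * y) * exp (2 * pi * (of_int (int m * k) / real N * y))"
        using elim A(2) by (intro prod_exponent_bound) auto
      then show ?case by (simp add: E_def distrib_right exp_add mult.assoc)
    qed
    moreover have "((\<lambda>y. exp (E * y)) \<longlongrightarrow> 0) at_top"
      using E by (intro exp_at_bot[THEN filterlim_compose] filterlim_tendsto_neg_mult_at_bot[of _ E] filterlim_ident) auto
    ultimately have "norm (prod_exponent N f m k) \<le> 0"
      by (intro tendsto_lowerbound[of _ 0 at_top]) auto
    then show ?thesis by simp
  qed
  then show ?thesis by blast
qed

text \<open>The exponents are bounded by e^(Am + 2 pi k/N), with k \<ge> -L. Powers of p must beat
  e^(Am) and also the negative powers of q, hence the condition Im \<sigma> > K Im \<tau>; powers of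
  q beat e^(2 pi k/N) as soon as Im \<tau> \<ge> 2.\<close>

lemma log_series_converges_near_infinity:
  "\<exists>K>0. \<forall>\<sigma> \<tau>. Im \<tau> > K \<and> Im \<sigma> > K * Im \<tau> \<longrightarrow> log_series_converges N f \<sigma> \<tau>"
proof -
  obtain A where A: "A \<ge> 0" "\<And>i j \<tau>. Im \<tau> \<ge> 1 \<Longrightarrow> norm (f i j \<tau>) \<le> exp (A * Im \<tau>)"
    "\<And>i j \<tau> m. m > 0 \<Longrightarrow> Im \<tau> = 1 / real m \<Longrightarrow> norm (f i j \<tau>) \<le> exp (A * real m)"
    using growth by blast
  obtain L :: nat where L: "\<And>m k. m > 0 \<Longrightarrow> k < - int L \<Longrightarrow> prod_exponent N f m k = 0"
    using prod_exponent_eq_0 by blast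
  \<comment> \<open>L pays for the negative powers of q and A for e^(Am); the 2 leaves decay in m
    and ensures Im \<tau> \<ge> 2.\<close>
  define K where "K = real L + A + 2"
  have K: "K \<ge> 2" using A(1) by (simp add: K_def)
  have "log_series_converges N f \<sigma> \<tau>" if y: "Im \<tau> > K" and s: "Im \<sigma> > K * Im \<tau>" for \<sigma> \<tau>
  proof -
    define y where "y = Im \<tau>"
    define g where "g = (\<lambda>(m :: nat, k :: int, i :: nat).
      exp (- real m) * ((if k < - int L then 0 else exp (- (real_of_int (k + int L) / real N))) * exp (1 - real i)))"
    have bound: "norm (prod_exponent N f m k * (pq_monomial N \<sigma> \<tau> m k ^ i / of_nat i)) \<le> g (m, k, i)"
      if m: "m \<ge> 1" and i: "i \<ge> 1" for m k i
    proof (cases "k < - int L")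
      case True
      then show ?thesis using L[of m k] m by (simp add: g_def)
    next
      case False
      define k' where "k' = real_of_int (k + int L) / real N"
      have k': "k' \<ge> 0" using False by (simp add: k'_def)
      have kk: "of_int k / real N = k' - real L / real N" by (simp add: k'_def add_divide_distrib)
      have LN: "real L / real N \<le> real L" "real L / real N \<ge> 0" using N_pos divide_left_mono[of 1 "real N" "real L"] by auto
      define P where "P = real m * Im \<sigma> - real L / real N * y"
      define Z where "Z = P + k' * y"
      have y2: "y \<ge> 2" "y > K" using y K by (auto simp: y_def)
      have P: "P \<ge> real m * (A + 2)"
      proof -
        have "real m * (K * y) \<le> real m * Im \<sigma>" using s by (intro mult_left_mono) (auto simp: y_def)
        moreover have "real L / real N * y \<le> real m * (real L * y)"
        proof -
          have "real L / real N * y \<le> real L * y" using LN y2 by (intro mult_right_mono) auto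
          also have "\<dots> \<le> real m * (real L * y)" using m y2 mult_right_mono[of 1 "real m" "real L * y"] by simp
          finally show ?thesis .
        qed
        ultimately have "real m * (A + 2) * y \<le> P" by (simp add: P_def K_def algebra_simps)
        moreover have "real m * (A + 2) * 1 \<le> real m * (A + 2) * y"
          using y2 A(1) by (intro mult_left_mono) auto
        ultimately show ?thesis by simp
      qed
      have mA: "real m * (A + 2) = real m * A + 2 * real m" "real m * A \<ge> 0"
        using A(1) by (auto simp: algebra_simps)
      have ky: "k' * y \<ge> 2 * k'" using mult_left_mono[OF y2(1) k'] by simp
      have Z1: "Z \<ge> 1" using P mA ky k' m unfolding Z_def by linarith
      have Z: "norm (pq_monomial N \<sigma> \<tau> m k) = exp (- (2 * pi * Z))"
      proof -
        have "Im (of_nat m * \<sigma>) + Im (of_int k / of_nat N * \<tau>) = real m * Im \<sigma> + of_int k / real N * y"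
          by (simp add: y_def)
        also have "\<dots> = Z" unfolding kk Z_def P_def by (simp add: algebra_simps)
        finally have *: "Im (of_nat m * \<sigma>) + Im (of_int k / of_nat N * \<tau>) = Z" .
        have "norm (pq_monomial N \<sigma> \<tau> m k) =
            exp (- 2 * pi * (Im (of_nat m * \<sigma>) + Im (of_int k / of_nat N * \<tau>)))"
          by (simp only: pq_monomial_def norm_mult norm_e2pi distrib_left exp_add)
        then show ?thesis unfolding * by simp
      qed
      have c: "norm (prod_exponent N f m k) \<le> exp (A * real m) * exp (2 * pi * k')"
      proof -
        have "norm (prod_exponent N f m k) \<le> exp (A * real m) * exp (2 * pi * (of_int (int m * k) / real N * (1 / real m)))"
          using m A(3)[of m] by (intro prod_exponent_bound) auto
        also have "of_int (int m * k) / real N * (1 / real m) = of_int k / real N" using m by simp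
        also have "exp (2 * pi * (of_int k / real N)) \<le> exp (2 * pi * k')"
          unfolding kk using LN by simp
        finally show ?thesis by simp
      qed
      have "norm (prod_exponent N f m k * (pq_monomial N \<sigma> \<tau> m k ^ i / of_nat i)) =
         norm (prod_exponent N f m k) * (exp (- (2 * pi * Z)) ^ i / real i)"
        by (simp add: norm_mult norm_divide norm_power Z)
      also have "\<dots> \<le> (exp (A * real m) * exp (2 * pi * k')) * (exp (- (2 * pi * Z)) ^ i / 1)"
        using c i by (intro mult_mono divide_left_mono) auto
      also have "\<dots> = exp (A * real m + 2 * pi * k' - 2 * pi * (real i * Z))"
        by (simp add: exp_diff exp_add exp_minus divide_simps mult_ac flip: exp_of_nat_mult)
      also have "\<dots> \<le> exp (- real m - k' + (1 - real i))"
      proof -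
        \<comment> \<open>One of the i factors |p^m q^(k/N)| is spent on the exponent; since Z \<ge>
          1, the other i - 1 give geometric decay in i.\<close>
        have "(real i - 1) * (Z - 1) \<ge> 0" using i Z1 by (intro mult_nonneg_nonneg) auto
        then have "real i * Z \<ge> Z + (real i - 1)" by (simp add: algebra_simps)
        then have Zi: "2 * pi * (Z + (real i - 1)) \<le> 2 * pi * (real i * Z)" by (intro mult_left_mono) auto
        \<comment> \<open>Of the 2k' contained in k' y, one k' cancels the growth e^(2 pi k') of the
          exponent and the other supplies the decay in k.\<close>
        have "1 * (P + k' + (real i - 1)) + 2 * pi * k' \<le> 2 * pi * (P + k' + (real i - 1)) + 2 * pi * k'"
          using pi_gt3 P mA k' m i by (intro add_right_mono mult_right_mono) auto
        also have "\<dots> = 2 * pi * (P + 2 * k' + (real i - 1))" by (simp add: algebra_simps)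
        also have "\<dots> \<le> 2 * pi * (Z + (real i - 1))"
          using ky by (intro mult_left_mono) (auto simp: Z_def)
        also note Zi
        finally have "A * real m + 2 * pi * k' - 2 * pi * (real i * Z) \<le> A * real m - (P + k' + (real i - 1))"
          by simp
        also have "\<dots> \<le> - real m - k' + (1 - real i)" using P mA by (simp add: mult.commute)
        finally show ?thesis by simp
      qed
      also have "- real m - k' + (1 - real i) = - real m + (- k' + (1 - real i))" by simp
      also have "exp \<dots> = g (m, k, i)"
        using False unfolding exp_add by (simp add: g_def k'_def)
      finally show ?thesis .
    qed
    have geo: "(\<lambda>i. exp (- (real i / real M))) summable_on UNIV" if "M > 0" for M :: nat
    proof -
      have "(\<lambda>i. exp (- (1 / real M)) ^ i) summable_on UNIV"
        by (intro norm_summable_imp_summable_on) (use that in \<open>auto simp: norm_power summable_geometric\<close>)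
      then show ?thesis by (simp flip: exp_of_nat_mult)
    qed
    have "g summable_on {1..} \<times> UNIV \<times> {1..}"
    proof -
      have 1: "(\<lambda>m. exp (- real m)) summable_on {1..}"
        using geo[of 1] by (auto intro: summable_on_subset)
      have 2: "(\<lambda>i. exp (1 - real i)) summable_on {1..}"
        using summable_on_cmult_right[OF 1, of "exp 1"] by (simp add: exp_diff exp_minus divide_inverse)
      have "(\<lambda>k. exp (- (real k / real N))) summable_on UNIV \<longleftrightarrow>
        (\<lambda>k. exp (- (real_of_int (k + int L) / real N))) summable_on {- int L..}"
        by (rule summable_on_reindex_bij_witness[of _ "\<lambda>k. nat (k + int L)" "\<lambda>n. int n - int L"]) auto
      also have "\<dots> \<longleftrightarrow> (\<lambda>k. if k < - int L then 0 else exp (- (real_of_int (k + int L) / real N))) summable_on UNIV"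
        by (rule summable_on_cong_neutral) auto
      finally have 3: "(\<lambda>k. if k < - int L then 0 else exp (- (real_of_int (k + int L) / real N))) summable_on UNIV"
        using geo[OF N_pos] by blast
      show ?thesis
        using summable_on_product_nonneg[OF 1 summable_on_product_nonneg[OF 3 2]]
        by (simp add: g_def case_prod_unfold)
    qed
    then show ?thesis
      unfolding log_series_converges_def
      by (rule summable_on_comparison_test) (use bound in auto)
  qed
  then show ?thesis using K by (intro exI[of _ K]) auto
qed

text \<open>The phase e(-bk/N) from Fourier inversion cancels the effect of the translation b/d on
  the factor q^(dk/N) split off by the twist. What is left is an untwisted average, which keeps the
  integral exponents divisible by d.\<close>

lemma has_sum_hecke_1_0:
  assumes \<tau>: "\<tau> \<in> uhp" and a: "a > 0" and d: "d > 0"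
  shows "((\<lambda>k. of_nat d * prod_exponent N f d k * e2pi (of_int k / of_nat N * (of_nat a * \<tau>))) has_sum
     (\<Sum>b<d. f (int d) (- int b) ((of_nat a * \<tau> + of_nat b) / of_nat d))) UNIV"
proof -
  define z where "z b = (of_nat a * \<tau> + of_nat b) / of_nat d" for b :: nat
  define h where "h k = of_nat d * prod_exponent N f d k * e2pi (of_int k / of_nat N * (of_nat a * \<tau>))" for k
  have z: "z b \<in> uhp" for b using \<tau> a d by (simp add: z_def uhp_def)
  have "(h has_sum (\<Sum>b<d. e2pi (of_int (- int b * k) / of_nat N) * vv N f (int d) k (z b))) {l. l mod int N = k}"
    if k: "k \<in> {0..<int N}" for k
  proof -
    define e where "e = e2pi (of_int k / of_nat N * (of_nat a * \<tau>))"
    have "e * vv_twist (int d) k (z b) = e2pi (of_int (- int b * k) / of_nat N) * vv N f (int d) k (z b)" for b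
    proof -
      have "of_int k / of_nat N * (of_nat a * \<tau>) + - (of_int (int d * k) / of_nat N * z b) =
        of_int (- int b * k) / of_nat N"
        using d N_pos by (simp add: z_def field_simps)
      then show ?thesis
        by (simp add: vv_twist_def e_def mult.left_commute[of _ "vv N f (int d) k (z b)"] mult.commute flip: e2pi_add)
    qed
    moreover have "((\<lambda>s. e * (of_nat d * twist_coeff (int d) k (int d * s) * e2pi (of_int s * (of_nat a * \<tau>)))) has_sum
        e * (\<Sum>b<d. vv_twist (int d) k (z b))) UNIV"
      unfolding z_def using \<tau> a d by (intro has_sum_cmult_right has_sum_hecke vv_twist_expansion)
    ultimately have "((\<lambda>s. e * (of_nat d * twist_coeff (int d) k (int d * s) * e2pi (of_int s * (of_nat a * \<tau>)))) has_sum
        (\<Sum>b<d. e2pi (of_int (- int b * k) / of_nat N) * vv N f (int d) k (z b))) UNIV"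
      by (simp only: sum_distrib_left)
    also have "?this \<longleftrightarrow> ?thesis"
    proof (rule has_sum_reindex_bij_witness[of _ "\<lambda>l. (l - k) div int N" "\<lambda>s. k + int N * s"])
      fix s
      have "of_int (k + int N * s) / of_nat N * (of_nat a * \<tau>) =
        of_int k / of_nat N * (of_nat a * \<tau>) + of_int s * (of_nat a * \<tau>)"
        using N_pos by (simp add: field_simps)
      then show "h (k + int N * s) =
         e * (of_nat d * twist_coeff (int d) k (int d * s) * e2pi (of_int s * (of_nat a * \<tau>)))"
        by (simp only: h_def e2pi_add prod_exponent_eq_twist_coeff) (simp add: e_def)
    next
      fix l assume "l \<in> {l. l mod int N = k}"
      then have "int N dvd l - k" by (auto simp: mod_eq_dvd_iff minus_mod_eq_mult_div)
      then show "k + int N * ((l - k) div int N) = l" by simp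
    qed (use N_pos k in auto)
    finally show ?thesis .
  qed
  then have "(h has_sum (\<Sum>k\<in>{0..<int N}. \<Sum>b<d. e2pi (of_int (- int b * k) / of_nat N) * vv N f (int d) k (z b)))
     (\<Union>k\<in>{0..<int N}. {l. l mod int N = k})"
    by (intro sum_has_sum) auto
  also have "(\<Union>k\<in>{0..<int N}. {l. l mod int N = k}) = UNIV" using N_pos by auto
  also have "(\<Sum>k\<in>{0..<int N}. \<Sum>b<d. e2pi (of_int (- int b * k) / of_nat N) * vv N f (int d) k (z b)) =
    (\<Sum>b<d. f (int d) (- int b) (z b))"
    by (subst sum.swap) (simp only: f_eq_sum_vv[OF z])
  finally show ?thesis by (simp add: h_def [abs_def] z_def)
qed

end

subsection \<open>Faber polynomials\<close>

text \<open>H e^L has derivative 0 on the open disc of radius |p|. As p may lie on the boundary of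
  the disc of convergence of L, its value there is reached by continuity: absolute convergence at p
  is uniform on the closed disc.\<close>

lemma eval_fps_eq_exp_if_deriv_eq:
  fixes H L :: "complex fps"
  assumes init: "fps_nth H 0 = 1" "fps_nth L 0 = 0"
    and ode: "fps_deriv H = - (fps_deriv L * H)"
    and H: "norm p < fps_conv_radius H"
    and L: "summable (\<lambda>n. norm (fps_nth L n * p ^ n))"
  shows "eval_fps H p = exp (- eval_fps L p)"
proof (cases "p = 0")
  case True
  then show ?thesis using init by (simp add: eval_fps_at_0)
next
  case False
  define R where "R = norm p"
  define \<phi> where "\<phi> z = eval_fps H z * exp (eval_fps L z)" for z
  have R: "R > 0" using False by (simp add: R_def)
  have radL: "fps_conv_radius L \<ge> R"
    unfolding R_def fps_conv_radius_def by (rule conv_radius_geI[OF summable_norm_cancel[OF L]])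
  have radH: "norm z < fps_conv_radius H" if "z \<in> cball 0 R" for z
    using H that by (auto simp: R_def intro: le_less_trans[of _ "ereal (norm p)"])
  have "continuous_on (cball 0 R) (eval_fps L)"
    unfolding eval_fps_def
  proof (rule uniform_limit_theorem[OF _ Weierstrass_m_test[where M = "\<lambda>n. norm (fps_nth L n * p ^ n)"]])
    show "norm (fps_nth L n * z ^ n) \<le> norm (fps_nth L n * p ^ n)" if "z \<in> cball 0 R" for z n
      using that by (auto simp: norm_mult norm_power R_def intro!: mult_left_mono power_mono)
  qed (use L in \<open>auto intro!: always_eventually continuous_intros\<close>)
  moreover have "continuous_on (cball 0 R) (eval_fps H)"
    using radH by (intro continuous_on_eval_fps' continuous_intros) auto
  ultimately have cont: "continuous_on (cball 0 R) \<phi>"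
    unfolding \<phi>_def by (intro continuous_on_mult continuous_on_exp)
  have deriv: "(\<phi> has_field_derivative 0) (at z within ball 0 R)" if z: "z \<in> ball 0 R" for z
  proof -
    have rH: "norm z < fps_conv_radius H" using z by (intro radH) auto
    have rL: "norm z < fps_conv_radius L"
      using z radL by (auto intro: less_le_trans[of _ "ereal R"])
    have rL': "norm z < fps_conv_radius (fps_deriv L)"
      using rL fps_conv_radius_deriv[of L] by (rule less_le_trans)
    have "eval_fps (fps_deriv H) z = - (eval_fps (fps_deriv L) z * eval_fps H z)"
      unfolding ode using rH rL' fps_conv_radius_mult[of "fps_deriv L" H]
      by (subst eval_fps_minus) (auto simp: eval_fps_mult intro: less_le_trans[of _ "min _ _"])
    then show ?thesis
      unfolding \<phi>_def
      by (auto intro!: derivative_eq_intros has_field_derivative_eval_fps rH rL simp: algebra_simps)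
  qed
  have "\<exists>c. \<forall>z\<in>ball 0 R. \<phi> z = c"
    using deriv by (intro has_field_derivative_zero_constant) auto
  then obtain c where c: "\<And>z. z \<in> ball 0 R \<Longrightarrow> \<phi> z = c" by blast
  have "c = 1" using c[of 0] R init by (simp add: \<phi>_def eval_fps_at_0)
  have "\<phi> p = 1"
  proof (rule continuous_constant_on_closure[where S = "ball 0 R" and f = \<phi> and x = p])
    show "continuous_on (closure (ball 0 R)) \<phi>" using cont R by simp
    show "p \<in> closure (ball 0 R)" using R by (simp add: R_def)
  qed (use c \<open>c = 1\<close> in auto)
  then show ?thesis by (simp add: \<phi>_def exp_minus field_simps)
qed

text \<open>
  The recurrence is that of the Faber polynomials $\Phi_n(x)$ of $p^{-1} + \sum_l a_l p^l$; it says that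
  $\sum_n \Phi_n(x) p^n / n$ is minus the logarithm of $1 - x p + \sum_l a_l p^{l+1}$.
\<close>

lemma faber_recurrence_imp_fps_deriv_eq:
  fixes a t :: "nat \<Rightarrow> complex"
  assumes t1: "t 1 = x"
    and rec: "\<And>m. t (m + 2) = x * t (m + 1) - (\<Sum>i<m. t (i + 1) * a (m - i)) - of_nat (m + 2) * a (m + 1)"
  defines "H \<equiv> Abs_fps (\<lambda>n. if n = 0 then 1 else if n = 1 then - x else a (n - 1))"
    and "L \<equiv> Abs_fps (\<lambda>n. t n / of_nat n)"
  shows "fps_deriv H = - (fps_deriv L * H)"
proof (rule fps_ext)
  fix n
  have L': "fps_nth (fps_deriv L) i = t (i + 1)" for i
    by (simp add: L_def del: of_nat_Suc)
  show "fps_nth (fps_deriv H) n = fps_nth (- (fps_deriv L * H)) n"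
  proof (cases n)
    case 0
    then show ?thesis using t1 by (simp add: H_def L_def)
  next
    case (Suc m)
    have "fps_nth (fps_deriv L * H) n = (\<Sum>i<Suc (Suc m). t (i + 1) * fps_nth H (n - i))"
      by (simp add: fps_mult_nth L' Suc atLeast0AtMost lessThan_Suc_atMost del: fps_deriv_nth)
    \<comment> \<open>The coefficients -x and 1 of H belong to i = m and i = m + 1.\<close>
    also have "\<dots> = (\<Sum>i<m. t (i + 1) * fps_nth H (n - i)) - x * t (m + 1) + t (m + 2)"
      by (simp add: Suc H_def)
    also have "(\<Sum>i<m. t (i + 1) * fps_nth H (n - i)) = (\<Sum>i<m. t (i + 1) * a (m - i))"
      by (intro sum.cong refl) (auto simp: H_def Suc Suc_diff_le less_imp_le)
    also have "\<dots> - x * t (m + 1) + t (m + 2) = - (of_nat (m + 2) * a (m + 1))"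
      using rec[of m] by simp
    finally show ?thesis by (simp add: Suc H_def)
  qed
qed

text \<open>This promotes an asymptotic relation along a single path to an identity of
  polynomials.\<close>

lemma poly_eq_0_if_tendsto_0:
  fixes P :: "complex poly"
  assumes g: "filterlim g at_infinity F" and P: "((\<lambda>y. poly P (g y)) \<longlongrightarrow> 0) F" and F: "F \<noteq> bot"
  shows "P = 0"
proof (cases "degree P > 0")
  case True
  then have "filterlim (\<lambda>y. poly P (g y)) at_infinity F"
    by (intro filterlim_compose[OF filterlim_poly_at_infinity g])
  then show ?thesis using P F not_tendsto_and_filterlim_at_infinity by blast
next
  case False
  then obtain c where c: "P = [:c:]" using degree_eq_zeroE by blast
  then have "((\<lambda>_. c) \<longlongrightarrow> 0) F" using P by simp
  then show ?thesis using F c by (simp add: tendsto_const_iff)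
qed

text \<open>All remaining exponents are at least L + 1. Relative to q^L, each term thus shrinks at
  least by e^(-2 pi (y - 1)) from height 1 to height y, and absolute convergence at height 1 makes
  this uniform.\<close>

lemma q_expansion_asymptotic:
  assumes F: "has_q_expansion 1 F c" and X: "finite X"
    and c0: "\<And>l. l \<le> L \<Longrightarrow> l \<notin> X \<Longrightarrow> c l = 0"
  shows "((\<lambda>y. (F (Complex 0 y) - (\<Sum>l\<in>X. c l * e2pi (of_int l * Complex 0 y))) /
            e2pi (of_int L * Complex 0 y)) \<longlongrightarrow> 0) at_top"
proof -
  define c' where "c' l = (if l \<in> X then 0 else c l)" for l
  define G where "G y = (F (Complex 0 y) - (\<Sum>l\<in>X. c l * e2pi (of_int l * Complex 0 y))) /
            e2pi (of_int L * Complex 0 y)" for y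
  define u where "u y l = c' l * e2pi (of_int l * Complex 0 y) / e2pi (of_int L * Complex 0 y)" for y l
  have u: "(u y has_sum G y) UNIV" if "y > 0" for y
  proof -
    have 1: "((\<lambda>l. c l * e2pi (of_int l * Complex 0 y)) has_sum F (Complex 0 y)) UNIV"
      using F that by (simp add: has_q_expansion_def uhp_def)
    have 2: "((\<lambda>l. if l \<in> X then c l * e2pi (of_int l * Complex 0 y) else 0) has_sum
        (\<Sum>l\<in>X. c l * e2pi (of_int l * Complex 0 y))) UNIV"
      using X by (intro has_sum_finite_neutralI) auto
    have "u y = (\<lambda>l. (c l * e2pi (of_int l * Complex 0 y) -
         (if l \<in> X then c l * e2pi (of_int l * Complex 0 y) else 0)) / e2pi (of_int L * Complex 0 y))"
      by (auto simp: u_def c'_def)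
    then show ?thesis
      unfolding G_def using has_sum_divide_const[OF has_sum_diff[OF 1 2]] by simp
  qed
  have norm_u: "norm (u y l) = norm (c' l) * exp (- 2 * pi * of_int (l - L) * y)" for y l
  proof -
    have "norm (u y l) = norm (c' l) * (exp (- 2 * pi * (of_int l * y)) / exp (- 2 * pi * (of_int L * y)))"
      by (simp add: u_def norm_mult norm_divide norm_e2pi)
    also have "exp (- 2 * pi * (of_int l * y)) / exp (- 2 * pi * (of_int L * y)) =
        exp (- 2 * pi * of_int (l - L) * y)"
      by (simp add: algebra_simps flip: exp_diff)
    finally show ?thesis .
  qed
  obtain S where S: "((\<lambda>l. norm (u 1 l)) has_sum S) UNIV"
    using has_sum_imp_summable[OF u[of 1]]
    by (auto simp: summable_on_iff_abs_summable_on_complex summable_on_def)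
  have "eventually (\<lambda>y. norm (G y) \<le> S * exp (- 2 * pi * (y - 1))) at_top"
    using eventually_ge_at_top[of 1]
  proof eventually_elim
    case (elim y)
    have bd: "norm (u y l) \<le> norm (u 1 l) * exp (- 2 * pi * (y - 1))" for l
    proof (cases "l \<le> L")
      case True
      then show ?thesis using c0[of l] by (auto simp: norm_u c'_def)
    next
      case False
      have "(real_of_int (l - L) - 1) * (y - 1) \<ge> 0" using False elim by (intro mult_nonneg_nonneg) auto
      then have "2 * pi * (real_of_int (l - L) + (y - 1)) \<le> 2 * pi * (real_of_int (l - L) * y)"
        by (intro mult_left_mono) (auto simp: algebra_simps)
      then have "exp (- 2 * pi * of_int (l - L) * y) \<le> exp (- 2 * pi * of_int (l - L) * 1) * exp (- 2 * pi * (y - 1))"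
        by (simp add: algebra_simps flip: exp_add)
      then show ?thesis
        unfolding norm_u mult.assoc by (intro mult_left_mono) (auto simp: mult.assoc)
    qed
    show ?case
      using elim by (intro norm_infsum_le[OF u has_sum_cmult_left[OF S] bd]) auto
  qed
  moreover have "((\<lambda>y. S * exp (- 2 * pi * (y - 1))) \<longlongrightarrow> 0) at_top"
    by real_asymp
  ultimately show ?thesis unfolding G_def [symmetric] by (rule Lim_null_comparison)
qed

text \<open>\<open>Q\<close>, \<open>g\<close>, \<open>t k\<close> stand for q, f at (1, g) and
  \<open>nT k f\<close> there, on the imaginary axis. The negative powers in
  \<open>g y * t (m + 1) y\<close> cancel against \<open>t (m + 2) y\<close> and the sum. Its
  constant term is a (m + 1) from \<open>g\<close>, plus (m + 1) a (m + 1) from 1/q times the linear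
  term of \<open>t (m + 1)\<close>; hence \<open>t\<close> must be known up to o(q).\<close>

lemma faber_tendsto:
  fixes Q g :: "real \<Rightarrow> complex" and a :: "nat \<Rightarrow> complex" and t :: "nat \<Rightarrow> real \<Rightarrow> complex"
  assumes Q0: "\<And>y. Q y \<noteq> 0" and Q: "(Q \<longlongrightarrow> 0) F"
    and gQ: "((\<lambda>y. g y * Q y) \<longlongrightarrow> 1) F"
    and r: "((\<lambda>y. (g y - (1 / Q y + (\<Sum>i<m. a (m - i) * Q y ^ (m - i)) + a (m + 1) * Q y ^ (m + 1))) /
                Q y ^ (m + 1)) \<longlongrightarrow> 0) F"
    and s: "\<And>k. k > 0 \<Longrightarrow> ((\<lambda>y. (t k y - (1 / Q y ^ k + of_nat k * a k * Q y)) / Q y) \<longlongrightarrow> 0) F"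
  shows "((\<lambda>y. t (m + 2) y - g y * t (m + 1) y + (\<Sum>i<m. t (i + 1) y * a (m - i)) + of_nat (m + 2) * a (m + 1))
           \<longlongrightarrow> 0) F"
proof -
  define R where "R y = (g y - (1 / Q y + (\<Sum>i<m. a (m - i) * Q y ^ (m - i)) + a (m + 1) * Q y ^ (m + 1))) /
                Q y ^ (m + 1)" for y
  define S where "S k y = (t k y - (1 / Q y ^ k + of_nat k * a k * Q y)) / Q y" for k y
  \<comment> \<open>The combination after cancellation of all negative powers, written in quantities
    whose limits are known.\<close>
  define E where "E y = of_nat (m + 2) * a (m + 2) * Q y + Q y * S (m + 2) y - R y
      - g y * Q y * (of_nat (m + 1) * a (m + 1) + S (m + 1) y) + of_nat (m + 1) * a (m + 1)
      + (\<Sum>i<m. a (m - i) * (of_nat (i + 1) * a (i + 1) * Q y + Q y * S (i + 1) y))" for y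
  have tS: "t k y = 1 / Q y ^ k + of_nat k * a k * Q y + Q y * S k y" for k y
    using Q0[of y] by (simp add: S_def)
  have "t (m + 2) y - g y * t (m + 1) y + (\<Sum>i<m. t (i + 1) y * a (m - i)) + of_nat (m + 2) * a (m + 1) = E y" for y
  proof -
    have "g y = 1 / Q y + (\<Sum>i<m. a (m - i) * Q y ^ (m - i)) + a (m + 1) * Q y ^ (m + 1) + R y * Q y ^ (m + 1)"
      using Q0[of y] by (simp add: R_def)
    then have "g y * (1 / Q y ^ (m + 1)) = 1 / Q y ^ (m + 2) +
        (\<Sum>i<m. a (m - i) * Q y ^ (m - i)) / Q y ^ (m + 1) + a (m + 1) + R y"
      using Q0[of y] by (simp add: field_simps)
    also have "(\<Sum>i<m. a (m - i) * Q y ^ (m - i)) / Q y ^ (m + 1) = (\<Sum>i<m. a (m - i) * (1 / Q y ^ (i + 1)))"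
      unfolding sum_divide_distrib
    proof (intro sum.cong refl)
      fix i assume "i \<in> {..<m}"
      then have "Q y ^ (m + 1) = Q y ^ (m - i) * Q y ^ (i + 1)" by (simp flip: power_add)
      then show "a (m - i) * Q y ^ (m - i) / Q y ^ (m + 1) = a (m - i) * (1 / Q y ^ (i + 1))"
        using Q0[of y] by (simp add: field_simps)
    qed
    finally have g': "g y * (1 / Q y ^ (m + 1)) = 1 / Q y ^ (m + 2) +
        (\<Sum>i<m. a (m - i) * (1 / Q y ^ (i + 1))) + a (m + 1) + R y" .
    have "g y * t (m + 1) y = g y * (1 / Q y ^ (m + 1)) + g y * Q y * (of_nat (m + 1) * a (m + 1) + S (m + 1) y)"
      unfolding tS[of "m + 1"] by (simp only: distrib_left mult_ac add.assoc)
    moreover have "(\<Sum>i<m. t (i + 1) y * a (m - i)) = (\<Sum>i<m. a (m - i) * (1 / Q y ^ (i + 1))) +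
        (\<Sum>i<m. a (m - i) * (of_nat (i + 1) * a (i + 1) * Q y + Q y * S (i + 1) y))"
      unfolding tS by (simp only: distrib_left distrib_right sum.distrib mult_ac add.assoc)
    ultimately show ?thesis
      unfolding g' tS[of "m + 2"] E_def by (simp add: algebra_simps)
  qed
  moreover have "(E \<longlongrightarrow> of_nat (m + 2) * a (m + 2) * 0 + 0 * 0 - 0
      - 1 * (of_nat (m + 1) * a (m + 1) + 0) + of_nat (m + 1) * a (m + 1)
      + (\<Sum>i<m. a (m - i) * (of_nat (i + 1) * a (i + 1) * 0 + 0 * 0))) F"
    unfolding E_def using s r unfolding S_def [symmetric] R_def [symmetric]
    by (intro tendsto_intros Q gQ) auto
  ultimately show ?thesis by simp
qed

section \<open>Hecke operators at (1, g) and the recurrence\<close>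

context hecke_monic_function
begin

definition a_coeff :: "int \<Rightarrow> int \<Rightarrow> complex" where
  "a_coeff j = q_coeff 1 (f 0 j)"

lemma f_0_expansion:
  shows "has_q_expansion 1 (f 0 j) (a_coeff j)"
    and "a_coeff j (- 1) = 1" "a_coeff j 0 = 0" "l < - 1 \<Longrightarrow> a_coeff j l = 0"
proof -
  obtain c where c: "has_q_expansion 1 (f 0 j) c" "c (- 1) = 1" "c 0 = 0" "\<forall>l < - 1. c l = 0"
    using f_normalized unfolding principally_normalized_def by blast
  moreover have "a_coeff j = c" unfolding a_coeff_def using c(1) by (rule q_coeff_eq[rotated]) simp
  ultimately show "has_q_expansion 1 (f 0 j) (a_coeff j)"
    "a_coeff j (- 1) = 1" "a_coeff j 0 = 0" "l < - 1 \<Longrightarrow> a_coeff j l = 0" by auto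
qed

text \<open>In the terms with ad = n, the power q^l of f(1, g^a) survives the sum over b only for l
  = ds, with weight d, and becomes q^(as).\<close>

definition hecke_coeff :: "nat \<Rightarrow> int \<Rightarrow> complex" where
  "hecke_coeff n r = (\<Sum>d | d dvd n. if int (n div d) dvd r
     then of_nat d * a_coeff (int (n div d)) (int d * (r div int (n div d))) else 0)"

lemma nT_0_1_expansion:
  assumes n: "n > 0"
  shows "has_q_expansion 1 (nT n f 0 1) (hecke_coeff n)"
  unfolding has_q_expansion_def
proof
  fix \<tau> assume \<tau>: "\<tau> \<in> uhp"
  have "((\<lambda>r. (if int (n div d) dvd r
     then of_nat d * a_coeff (int (n div d)) (int d * (r div int (n div d))) else 0) * e2pi (of_int r * \<tau>))
     has_sum (\<Sum>b<d. f 0 (int (n div d)) ((of_nat (n div d) * \<tau> + of_nat b) / of_nat d))) UNIV"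
    (is "(?g has_sum ?S) UNIV") if d: "d dvd n" for d
  proof -
    have d0: "d > 0" "n div d > 0" using d n by (auto simp: dvd_div_eq_0_iff intro!: Nat.gr0I)
    from has_sum_hecke[OF f_0_expansion(1)[of "int (n div d)"] \<tau> d0(2,1)]
    have "((\<lambda>s. of_nat d * a_coeff (int (n div d)) (int d * s) * e2pi (of_int s * (of_nat (n div d) * \<tau>)))
      has_sum ?S) UNIV" .
    also have "?this \<longleftrightarrow> (?g has_sum ?S) (range (\<lambda>s. int (n div d) * s))"
      using d0(2) by (subst has_sum_reindex) (auto simp: inj_on_def o_def mult_ac)
    also have "\<dots> \<longleftrightarrow> (?g has_sum ?S) UNIV"
      by (rule has_sum_cong_neutral) auto
    finally show ?thesis .
  qed
  then show "((\<lambda>r. hecke_coeff n r * e2pi (of_int r * \<tau> / of_nat 1)) has_sum nT n f 0 1 \<tau>) UNIV"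
    unfolding nT_conv_divisors[OF n] hecke_coeff_def sum_distrib_right
    by (intro has_sum_finite_sum) simp
qed

text \<open>A contribution to r = as \<le> 0 comes from q^(ds) with ds \<le> 0, and the
  normalization of every f(1, g^i) leaves only ds = -1, that is d = 1 and r = -n.\<close>

lemma hecke_coeff_nonpos:
  assumes n: "n > 0" and r: "r \<le> 0"
  shows "hecke_coeff n r = (if r = - int n then 1 else 0)"
proof -
  have 0: "(if int (n div d) dvd r
     then of_nat d * a_coeff (int (n div d)) (int d * (r div int (n div d))) else 0) =
     (if d = 1 \<and> r = - int n then 1 else 0)" if d: "d dvd n" for d
  proof (cases "int (n div d) dvd r")
    case False
    then show ?thesis using n by auto
  next
    case True
    have d0: "d > 0" "n div d > 0" using d n by (auto simp: dvd_div_eq_0_iff intro!: Nat.gr0I)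
    define s where "s = r div int (n div d)"
    have rs: "r = int (n div d) * s" using True by (simp add: s_def)
    then have s0: "s \<le> 0" using r d0 by (metis linorder_not_le of_nat_0_less_iff mult_pos_pos)
    consider "s = 0" | "s = - 1" "d = 1" | "int d * s < - 1"
    proof (cases "s = 0 \<or> (s = - 1 \<and> d = 1)")
      case False
      then have "s \<le> -1" using s0 by auto
      have "int d * s < - 1"
      proof (cases "d = 1")
        case True
        then show ?thesis using False \<open>s \<le> -1\<close> by auto
      next
        case False
        then have "int d * s \<le> 2 * s" using d0 s0 by (intro mult_right_mono_neg) auto
        then show ?thesis using \<open>s \<le> -1\<close> by linarith
      qed
      then show ?thesis using that by blast
    qed (use that in blast)
    then show ?thesis
    proof cases
      case 1
      then have "r = 0" using rs by simp
      then show ?thesis using n by (simp add: f_0_expansion)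
    next
      case 2
      have "r div int (n div d) = - 1" using 2(1) by (simp only: s_def)
      moreover have "r = - int n" using rs 2 by simp
      ultimately show ?thesis using \<open>d = 1\<close> True by (simp add: f_0_expansion)
    next
      case 3
      moreover have "\<not> (d = 1 \<and> r = - int n)"
      proof
        assume *: "d = 1 \<and> r = - int n"
        have "int (n div d) * s = - int n" using rs * by (simp only:)
        then have "int n * s = int n * (- 1)" using * by (simp only: div_by_1)
        then have "s = - 1" using n by (subst (asm) mult_cancel_left) simp
        then show False using 3 * by simp
      qed
      ultimately show ?thesis using True by (auto simp: f_0_expansion s_def)
    qed
  qed
  have "hecke_coeff n r = (\<Sum>d | d dvd n. if d = 1 \<and> r = - int n then 1 else 0)"
    unfolding hecke_coeff_def by (intro sum.cong refl 0) auto
  also have "\<dots> = (\<Sum>d\<in>{1 :: nat}. if d = 1 \<and> r = - int n then 1 else 0)"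
    using n by (intro sum.mono_neutral_right) auto
  finally show ?thesis by simp
qed

text \<open>The divisor a = n/d must divide 1, so among all f(1, g^a) only f(1, g)
  contributes.\<close>

lemma hecke_coeff_1:
  assumes n: "n > 0"
  shows "hecke_coeff n 1 = of_nat n * a_coeff 1 (int n)"
proof -
  have "n div d = 1 \<longleftrightarrow> d = n" if "d dvd n" for d
    using that n by (auto elim!: dvdE)
  then have "hecke_coeff n 1 = (\<Sum>d | d dvd n. if d = n then of_nat n * a_coeff 1 (int n) else 0)"
    unfolding hecke_coeff_def using n by (intro sum.cong refl) (auto simp: zdvd1_eq)
  also have "\<dots> = of_nat n * a_coeff 1 (int n)" using n by simp
  finally show ?thesis .
qed

lemma nT_1_0_recurrence:
  assumes \<tau>: "\<tau> \<in> uhp"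
  shows "nT (m + 2) f 1 0 \<tau> = f 1 0 \<tau> * nT (m + 1) f 1 0 \<tau> -
    (\<Sum>i<m. nT (i + 1) f 1 0 \<tau> * a_coeff 1 (int (m - i))) - of_nat (m + 2) * a_coeff 1 (int (m + 1))"
proof -
  have orbit: "(1, 0) \<in> SL2_orbit N 0 1"
    unfolding SL2_orbit_def
    by (rule CollectI, unfold prod.case,
        rule exI[of _ 0], rule exI[of _ "-1"], rule exI[of _ 1], rule exI[of _ 0]) simp
  have "\<exists>\<Phi>. \<forall>\<tau>\<in>uhp. nT n f 0 1 \<tau> = poly \<Phi> (f 0 1 \<tau>) \<and> nT n f 1 0 \<tau> = poly \<Phi> (f 1 0 \<tau>)"
    if n: "n > 0" for n
  proof -
    obtain \<Phi> where "\<forall>(i, j) \<in> SL2_orbit N 0 1. \<forall>\<tau>\<in>uhp. nT n f i j \<tau> = poly \<Phi> (f i j \<tau>)"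
      using f_Hecke_monic n unfolding Hecke_monic_def by blast
    then show ?thesis using orbit SL2_orbit_self[of 0 1 N] by fastforce
  qed
  then obtain \<Phi> where \<Phi>: "\<And>n \<tau>. n > 0 \<Longrightarrow> \<tau> \<in> uhp \<Longrightarrow> nT n f 0 1 \<tau> = poly (\<Phi> n) (f 0 1 \<tau>)"
      "\<And>n \<tau>. n > 0 \<Longrightarrow> \<tau> \<in> uhp \<Longrightarrow> nT n f 1 0 \<tau> = poly (\<Phi> n) (f 1 0 \<tau>)"
    by metis
  define a where "a k = a_coeff 1 (int k)" for k
  \<comment> \<open>The recurrence with an indeterminate in place of the value of f; the aim is P =
    0.\<close>
  define P where "P = \<Phi> (m + 2) - [:0, 1:] * \<Phi> (m + 1) + (\<Sum>i<m. smult (a (m - i)) (\<Phi> (i + 1)))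
     + [:of_nat (m + 2) * a (m + 1):]"
  have P: "poly P z = poly (\<Phi> (m + 2)) z - z * poly (\<Phi> (m + 1)) z +
     (\<Sum>i<m. poly (\<Phi> (i + 1)) z * a (m - i)) + of_nat (m + 2) * a (m + 1)" for z
    by (simp add: P_def poly_sum mult_ac)
  define Q where "Q y = e2pi (Complex 0 y)" for y
  define g where "g y = f 0 1 (Complex 0 y)" for y
  have Qpow: "e2pi (of_nat k * Complex 0 y) = Q y ^ k" "e2pi (- (of_nat k * Complex 0 y)) = 1 / Q y ^ k" for k y
    by (simp_all add: Q_def e2pi_power e2pi_minus divide_inverse)
  have Qm: "e2pi (- Complex 0 y) = 1 / Q y" for y using Qpow(2)[of 1 y] by simp
  have Q0: "Q y \<noteq> 0" for y by (simp add: Q_def)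
  have Q: "(Q \<longlongrightarrow> 0) at_top"
  proof (rule tendsto_norm_zero_cancel)
    have "((\<lambda>y. exp (- 2 * pi * y)) \<longlongrightarrow> 0) at_top" by real_asymp
    then show "((\<lambda>y. norm (Q y)) \<longlongrightarrow> 0) at_top" by (simp add: Q_def norm_e2pi)
  qed
  have gQ: "((\<lambda>y. g y * Q y) \<longlongrightarrow> 1) at_top"
  proof -
    have "((\<lambda>y. (g y - 1 / Q y) / (1 / Q y)) \<longlongrightarrow> 0) at_top"
      using q_expansion_asymptotic[OF f_0_expansion(1)[of 1], of "{-1}" "-1"]
      by (simp add: f_0_expansion g_def Qm)
    moreover have "(g y - 1 / Q y) / (1 / Q y) = g y * Q y - 1" for y
      using Q0[of y] by (simp add: field_simps)
    ultimately show ?thesis using Lim_null[of "\<lambda>y. g y * Q y" 1] by simp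
  qed
  have r: "((\<lambda>y. (g y - (1 / Q y + (\<Sum>i<m. a (m - i) * Q y ^ (m - i)) + a (m + 1) * Q y ^ (m + 1))) /
                Q y ^ (m + 1)) \<longlongrightarrow> 0) at_top"
  proof -
    \<comment> \<open>The indices -1, 1, ..., m + 1, parametrized as in
      \<open>faber_tendsto\<close>; 0 is left out because the constant term vanishes.\<close>
    define X where "X = insert (-1) (insert (int (m + 1)) ((\<lambda>i. int (m - i)) ` {..<m}))"
    have 0: "a_coeff 1 l = 0" if "l \<le> int (m + 1)" "l \<notin> X" for l
    proof -
      have "l \<le> 0"
      proof (rule ccontr)
        assume "\<not> l \<le> 0"
        then have "l = int (m - (m - nat l)) \<and> m - nat l < m \<or> l = int (m + 1)"
          using that(1) by auto
        then show False using that(2) by (auto simp: X_def)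
      qed
      then show ?thesis
        using that(2) f_0_expansion(3)[of 1] f_0_expansion(4)[of l 1] by (cases "l = 0") (auto simp: X_def)
    qed
    have inj: "inj_on (\<lambda>i. int (m - i)) {..<m}" by (auto simp: inj_on_def)
    have sum: "(\<Sum>l\<in>X. a_coeff 1 l * e2pi (of_int l * Complex 0 y)) =
        1 / Q y + (\<Sum>i<m. a (m - i) * Q y ^ (m - i)) + a (m + 1) * Q y ^ (m + 1)" for y
    proof -
      have n1: "int (m + 1) \<notin> (\<lambda>i. int (m - i)) ` {..<m}" by auto
      have n2: "-1 \<notin> insert (int (m + 1)) ((\<lambda>i. int (m - i)) ` {..<m})" by auto
      have "(\<Sum>l\<in>X. a_coeff 1 l * e2pi (of_int l * Complex 0 y)) =
        a_coeff 1 (-1) * e2pi (of_int (-1) * Complex 0 y) + (a_coeff 1 (int (m + 1)) * e2pi (of_int (int (m + 1)) * Complex 0 y)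
         + (\<Sum>i<m. a_coeff 1 (int (m - i)) * e2pi (of_int (int (m - i)) * Complex 0 y)))"
        unfolding X_def using n1 n2 by (simp only: sum.insert finite_imageI finite_insert finite_lessThan sum.reindex[OF inj] o_def not_False_eq_True)
      then show ?thesis
        by (simp only: of_int_of_nat_eq Qpow a_def f_0_expansion) (simp add: Qm)
    qed
    have "((\<lambda>y. (f 0 1 (Complex 0 y) - (\<Sum>l\<in>X. a_coeff 1 l * e2pi (of_int l * Complex 0 y))) /
            e2pi (of_int (int (m + 1)) * Complex 0 y)) \<longlongrightarrow> 0) at_top"
      by (rule q_expansion_asymptotic[OF f_0_expansion(1) _ 0]) (auto simp: X_def)
    then show ?thesis unfolding sum of_int_of_nat_eq Qpow g_def .
  qed
  have s: "((\<lambda>y. (nT k f 0 1 (Complex 0 y) - (1 / Q y ^ k + of_nat k * a k * Q y)) / Q y) \<longlongrightarrow> 0) at_top"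
    if k: "k > 0" for k
  proof -
    have "((\<lambda>y. (nT k f 0 1 (Complex 0 y) - (\<Sum>l\<in>{- int k, 1}. hecke_coeff k l * e2pi (of_int l * Complex 0 y))) /
       e2pi (of_int 1 * Complex 0 y)) \<longlongrightarrow> 0) at_top"
    proof (rule q_expansion_asymptotic[OF nT_0_1_expansion[OF k]])
      fix l :: int assume "l \<le> 1" "l \<notin> {- int k, 1}"
      then show "hecke_coeff k l = 0"
        using hecke_coeff_nonpos[OF k, of l] by (cases "l \<le> 0") auto
    qed simp
    moreover have "(\<Sum>l\<in>{- int k, 1}. hecke_coeff k l * e2pi (of_int l * Complex 0 y)) = 1 / Q y ^ k + of_nat k * a k * Q y" for y
      using k by (simp add: hecke_coeff_nonpos hecke_coeff_1 Qpow a_def) (simp add: Q_def)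
    ultimately show ?thesis by (simp add: Q_def)
  qed
  have "((\<lambda>y. poly P (g y)) \<longlongrightarrow> 0) at_top"
  proof (rule Lim_transform_eventually[OF faber_tendsto[OF Q0 Q gQ r s]])
    show "\<forall>\<^sub>F y in at_top. nT (m + 2) f 0 1 (Complex 0 y) - g y * nT (m + 1) f 0 1 (Complex 0 y) +
        (\<Sum>i<m. nT (i + 1) f 0 1 (Complex 0 y) * a (m - i)) + of_nat (m + 2) * a (m + 1) = poly P (g y)"
      using eventually_gt_at_top[of 0]
    proof eventually_elim
      case (elim y)
      then have "Complex 0 y \<in> uhp" by (simp add: uhp_def)
      then show ?case unfolding P by (simp add: \<Phi>(1) g_def)
    qed
  qed
  moreover have "filterlim g at_infinity at_top"
  proof -
    have "filterlim Q (at 0) at_top" using Q Q0 by (simp add: filterlim_at)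
    then have "filterlim (\<lambda>y. inverse (Q y)) at_infinity at_top"
      by (rule filterlim_compose[OF filterlim_inverse_at_infinity])
    then have "filterlim (\<lambda>y. g y * Q y * inverse (Q y)) at_infinity at_top"
      by (intro tendsto_mult_filterlim_at_infinity[OF gQ]) auto
    then show ?thesis using Q0 by (simp add: mult.assoc)
  qed
  ultimately have "P = 0" by (intro poly_eq_0_if_tendsto_0[of g at_top]) auto
  then have "poly P (f 1 0 \<tau>) = 0" by simp
  then show ?thesis
    unfolding P using \<Phi>(2)[OF _ \<tau>] by (simp add: a_def algebra_simps eq_neg_iff_add_eq_0)
qed

end

subsection \<open>The product expansion\<close>

lemma obtain_e2pi:
  assumes "z \<noteq> 0" "norm z < 1"
  obtains \<sigma> where "\<sigma> \<in> uhp" "z = e2pi \<sigma>"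
proof
  define \<sigma> where "\<sigma> = Ln z / (2 * of_real pi * \<i>)"
  show z: "z = e2pi \<sigma>" using assms by (simp add: e2pi_def \<sigma>_def)
  then have "exp (- 2 * pi * Im \<sigma>) < 1" using assms(2) by (simp add: norm_e2pi)
  then show "\<sigma> \<in> uhp" by (simp add: uhp_def zero_less_mult_iff)
qed

lemma one_minus_pow_eq_exp:
  assumes "((\<lambda>i. c * (x ^ i / of_nat i)) has_sum v) {1 :: nat..}"
  shows "one_minus_pow x c = exp (- v)"
proof (cases "c = 0")
  \<comment> \<open>For c = 0 the logarithm series itself may diverge, and the hypothesis says
    nothing about it; for other c one can divide by c.\<close>
  case True
  then have "((\<lambda>_. 0) has_sum v) {1 :: nat..}" using assms by simp
  then have "v = 0" using has_sum_0_simp by (rule has_sum_unique)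
  then show ?thesis using True by (simp add: one_minus_pow_def)
next
  case False
  have "((\<lambda>i. c * (x ^ Suc i / of_nat (Suc i))) has_sum v) UNIV \<longleftrightarrow>
      ((\<lambda>i. c * (x ^ i / of_nat i)) has_sum v) {1 :: nat..}"
    by (rule has_sum_reindex_bij_witness[of _ "\<lambda>i. i - 1" Suc]) auto
  then have "(\<lambda>i. c * (x ^ Suc i / of_nat (Suc i))) sums v"
    using assms has_sum_imp_sums by blast
  then have "(\<lambda>i. x ^ Suc i / of_nat (Suc i)) sums (v / c)"
    using False sums_mult_iff[of c "\<lambda>i. x ^ Suc i / of_nat (Suc i)" "v / c"] by simp
  then show ?thesis using False by (simp add: one_minus_pow_def sums_unique [symmetric])
qed

context hecke_monic_function
begin

text \<open>With n = mi, p^n / i = (p^n / n) m, and m is the weight of the Hecke terms with d = m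
  and a = i.\<close>

lemma has_sum_log_series_hecke:
  assumes \<tau>: "\<tau> \<in> uhp" and n: "n > 0"
    and summable: "(\<lambda>(m, k). prod_exponent N f m k * (pq_monomial N \<sigma> \<tau> m k ^ (n div m) / of_nat (n div m)))
       summable_on ({m. m dvd n} \<times> UNIV)"
  shows "((\<lambda>(m, k). prod_exponent N f m k * (pq_monomial N \<sigma> \<tau> m k ^ (n div m) / of_nat (n div m)))
       has_sum (nT n f 1 0 \<tau> / of_nat n * e2pi \<sigma> ^ n)) ({m. m dvd n} \<times> UNIV)"
proof (rule has_sum_SigmaI[OF _ _ summable])
  define E where "E m = (\<Sum>b<m. f (int m) (- int b) ((of_nat (n div m) * \<tau> + of_nat b) / of_nat m))" for m
  define s where "s = e2pi \<sigma> ^ n / of_nat n"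
  fix m assume m: "m \<in> {m. m dvd n}"
  define a where "a = n div m"
  have nma: "n = m * a" and pos: "m > 0" "a > 0" using m n by (auto simp: a_def intro!: Nat.gr0I)
  have "((\<lambda>k. s * (of_nat m * prod_exponent N f m k * e2pi (of_int k / of_nat N * (of_nat a * \<tau>)))) has_sum s * E m) UNIV"
    unfolding E_def a_def [symmetric] by (intro has_sum_cmult_right has_sum_hecke_1_0 \<tau> pos)
  moreover have "s * (of_nat m * prod_exponent N f m k * e2pi (of_int k / of_nat N * (of_nat a * \<tau>))) =
      prod_exponent N f m k * (pq_monomial N \<sigma> \<tau> m k ^ a / of_nat a)" for k
  proof -
    have "pq_monomial N \<sigma> \<tau> m k ^ a = e2pi \<sigma> ^ n * e2pi (of_int k / of_nat N * (of_nat a * \<tau>))"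
      by (simp add: pq_monomial_def power_mult_distrib e2pi_power nma mult_ac)
    then show ?thesis using pos by (simp add: s_def nma field_simps)
  qed
  ultimately show "((\<lambda>k. case (m, k) of (m, k) \<Rightarrow>
      prod_exponent N f m k * (pq_monomial N \<sigma> \<tau> m k ^ (n div m) / of_nat (n div m))) has_sum s * E m) UNIV"
    by (simp add: a_def)
next
  show "((\<lambda>m. e2pi \<sigma> ^ n / of_nat n *
      (\<Sum>b<m. f (int m) (- int b) ((of_nat (n div m) * \<tau> + of_nat b) / of_nat m))) has_sum
      nT n f 1 0 \<tau> / of_nat n * e2pi \<sigma> ^ n) {m. m dvd n}"
  proof (rule has_sum_finiteI)
    show "finite {m. m dvd n}" using n by simp
    show "nT n f 1 0 \<tau> / of_nat n * e2pi \<sigma> ^ n = (\<Sum>m | m dvd n. e2pi \<sigma> ^ n / of_nat n *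
      (\<Sum>b<m. f (int m) (- int b) ((of_nat (n div m) * \<tau> + of_nat b) / of_nat m)))"
      by (subst sum_distrib_left [symmetric]) (simp add: nT_conv_divisors[OF n])
  qed
qed

text \<open>The power series in p of p (f(1, g, \<sigma>) - x); its linear coefficient is a_0 - x,
  where a_0 = 0 by normalization.\<close>

definition principal_fps :: "complex \<Rightarrow> complex fps" where
  "principal_fps x = Abs_fps (\<lambda>n. if n = 0 then 1 else if n = 1 then - x else a_coeff 1 (int (n - 1)))"

lemma principal_fps_sums:
  assumes \<sigma>: "\<sigma> \<in> uhp"
  shows "(\<lambda>n. fps_nth (principal_fps x) n * e2pi \<sigma> ^ n) sums (e2pi \<sigma> * (f 0 1 \<sigma> - x))"
proof -
  define p where "p = e2pi \<sigma>"
  have "((\<lambda>l. p * (a_coeff 1 l * e2pi (of_int l * \<sigma>))) has_sum p * f 0 1 \<sigma>) UNIV"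
    using f_0_expansion(1)[of 1] \<sigma> by (intro has_sum_cmult_right) (simp add: has_q_expansion_def)
  also have "?this \<longleftrightarrow> ((\<lambda>l. p * (a_coeff 1 l * e2pi (of_int l * \<sigma>))) has_sum p * f 0 1 \<sigma>) {-1..}"
    by (rule has_sum_cong_neutral) (auto simp: f_0_expansion(4))
  also have "\<dots> \<longleftrightarrow> ((\<lambda>n. a_coeff 1 (int n - 1) * p ^ n) has_sum p * f 0 1 \<sigma>) UNIV"
  proof (rule has_sum_reindex_bij_witness[of _ "\<lambda>n. int n - 1" "\<lambda>l. nat (l + 1)"])
    fix l :: int assume l: "l \<in> {-1..}"
    have "of_nat (nat (l + 1)) * \<sigma> = \<sigma> + of_int l * \<sigma>" using l by (simp add: distrib_right)
    then have "p ^ nat (l + 1) = p * e2pi (of_int l * \<sigma>)" by (simp only: p_def e2pi_power e2pi_add)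
    then show "a_coeff 1 (int (nat (l + 1)) - 1) * p ^ nat (l + 1) = p * (a_coeff 1 l * e2pi (of_int l * \<sigma>))"
      using l by simp
  qed auto
  finally have "((\<lambda>n. a_coeff 1 (int n - 1) * p ^ n) has_sum p * f 0 1 \<sigma>) UNIV" .
  moreover have "((\<lambda>n. if n = 1 then x * p else 0) has_sum x * p) UNIV"
    by (rule has_sum_finite_neutralI[of "{1}"]) auto
  ultimately have "((\<lambda>n. a_coeff 1 (int n - 1) * p ^ n - (if n = 1 then x * p else 0)) has_sum
      p * f 0 1 \<sigma> - x * p) UNIV"
    by (rule has_sum_diff)
  moreover have "a_coeff 1 (int n - 1) * p ^ n - (if n = 1 then x * p else 0) = fps_nth (principal_fps x) n * p ^ n" for n
    by (auto simp: principal_fps_def f_0_expansion of_nat_diff)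
  ultimately show ?thesis
    using has_sum_imp_sums[of _ "p * f 0 1 \<sigma> - x * p"] unfolding p_def by (simp add: algebra_simps)
qed

text \<open>Every r in (0, 1) is a value of p at which the expansion converges.\<close>

lemma principal_fps_radius: "fps_conv_radius (principal_fps x) \<ge> 1"
  unfolding fps_conv_radius_def
proof (rule conv_radius_geI_ex')
  fix r :: real assume "0 < r" "ereal r < 1"
  then obtain \<sigma> where "\<sigma> \<in> uhp" "of_real r = e2pi \<sigma>"
    using obtain_e2pi[of "of_real r"] by (auto simp: one_ereal_def)
  then show "summable (\<lambda>n. fps_nth (principal_fps x) n * of_real r ^ n)"
    using principal_fps_sums sums_summable by metis
qed

text \<open>One absolutely convergent triple sum S is grouped in two ways: by n = mi it becomes the
  series in \<open>nT n f 1 0 \<tau>\<close>, and by (m, k) it gives minus the logarithms of the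
  factors of the product.\<close>

lemma product_expansion:
  assumes \<sigma>: "\<sigma> \<in> uhp" and \<tau>: "\<tau> \<in> uhp" and conv: "log_series_converges N f \<sigma> \<tau>"
  shows "has_product_expansion N f \<sigma> \<tau> (f 0 1 \<sigma> - f 1 0 \<tau>)"
proof -
  define u where "u = (\<lambda>(m, k, i). prod_exponent N f m k * (pq_monomial N \<sigma> \<tau> m k ^ i / of_nat i))"
  define T where "T = {1 :: nat..} \<times> (UNIV :: int set) \<times> {1 :: nat..}"
  define p where "p = e2pi \<sigma>"
  define x where "x = f 1 0 \<tau>"
  define t where "t n = nT n f 1 0 \<tau>" for n
  have "(\<lambda>z. norm (u z)) summable_on T"
    using conv unfolding log_series_converges_def u_def T_def by (simp add: case_prod_unfold)
  then have "u summable_on T" by (simp add: summable_on_iff_abs_summable_on_complex)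
  then obtain S where S: "(u has_sum S) T" by (auto simp: summable_on_def)

  have "(u has_sum S) T \<longleftrightarrow>
      ((\<lambda>(n, m, k). u (m, k, n div m)) has_sum S) (Sigma {1..} (\<lambda>n. {m. m dvd n} \<times> UNIV))"
    unfolding T_def
    by (rule has_sum_reindex_bij_witness[of _ "\<lambda>(n, m, k). (m, k, n div m)" "\<lambda>(m, k, i). (m * i, m, k)"])
       (auto simp: Suc_le_eq dvd_div_eq_0_iff intro!: Nat.gr0I)
  then have S1: "((\<lambda>(n, m, k). u (m, k, n div m)) has_sum S) (Sigma {1..} (\<lambda>n. {m. m dvd n} \<times> UNIV))"
    using S by blast
  have t_sum: "((\<lambda>n. t n / of_nat n * p ^ n) has_sum S) {1..}"
  proof (rule has_sum_SigmaD[OF S1])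
    fix n :: nat assume n: "n \<in> {1..}"
    have "(\<lambda>(m, k). u (m, k, n div m)) summable_on ({m. m dvd n} \<times> UNIV)"
      using summable_on_SigmaD1[OF has_sum_imp_summable[OF S1] n] .
    then have "(\<lambda>(m, k). prod_exponent N f m k * (pq_monomial N \<sigma> \<tau> m k ^ (n div m) / of_nat (n div m)))
       summable_on ({m. m dvd n} \<times> UNIV)"
      by (simp add: u_def)
    from has_sum_log_series_hecke[OF \<tau> _ this]
    show "((\<lambda>y. case (n, y) of (n, m, k) \<Rightarrow> u (m, k, n div m)) has_sum t n / of_nat n * p ^ n) ({m. m dvd n} \<times> UNIV)"
      using n by (simp add: u_def t_def p_def)
  qed

  \<comment> \<open>Division by zero gives 0, so the constant term of L vanishes.\<close>
  define L where "L = Abs_fps (\<lambda>n. t n / of_nat n)"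
  have L_sum: "((\<lambda>n. fps_nth L n * p ^ n) has_sum S) UNIV"
    using t_sum by (rule has_sum_cong_neutral[THEN iffD1, rotated -1]) (auto simp: L_def not_less_eq_eq)
  have "(\<lambda>n. norm (fps_nth L n * p ^ n)) summable_on UNIV"
    using has_sum_imp_summable[OF L_sum] by (simp add: summable_on_iff_abs_summable_on_complex)
  then have L_norm: "summable (\<lambda>n. norm (fps_nth L n * p ^ n))" by (rule summable_on_imp_summable)
  have L_eval: "eval_fps L p = S"
    unfolding eval_fps_def using has_sum_imp_sums[OF L_sum] by (simp add: sums_iff)
  have "norm p < 1" using \<sigma> by (simp add: p_def norm_e2pi uhp_def)
  then have "norm p < fps_conv_radius (principal_fps x)"
    using principal_fps_radius[of x] by (auto intro: less_le_trans[of _ "ereal 1"] simp: one_ereal_def)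
  moreover have "fps_deriv (principal_fps x) = - (fps_deriv L * principal_fps x)"
    unfolding principal_fps_def L_def
  proof (rule faber_recurrence_imp_fps_deriv_eq[where a = "\<lambda>k. a_coeff 1 (int k)"])
    show "t 1 = x" by (simp add: t_def x_def nT_conv_divisors)
  qed (unfold t_def x_def, rule nT_1_0_recurrence[OF \<tau>])
  ultimately have "eval_fps (principal_fps x) p = exp (- eval_fps L p)"
    using L_norm by (intro eval_fps_eq_exp_if_deriv_eq) (auto simp: principal_fps_def L_def)
  moreover have "eval_fps (principal_fps x) p = p * (f 0 1 \<sigma> - x)"
    unfolding eval_fps_def p_def using principal_fps_sums[OF \<sigma>] by (simp add: sums_iff)
  ultimately have exp_S: "e2pi (- \<sigma>) * exp (- S) = f 0 1 \<sigma> - f 1 0 \<tau>"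
    by (simp add: L_eval[unfolded p_def] p_def x_def e2pi_minus field_simps)

  have "(u has_sum S) T \<longleftrightarrow>
      ((\<lambda>(mk, i). u (fst mk, snd mk, i)) has_sum S) (Sigma ({1..} \<times> UNIV) (\<lambda>_. {1..}))"
    unfolding T_def
    by (rule has_sum_reindex_bij_witness[of _ "\<lambda>((m, k), i). (m, k, i)" "\<lambda>(m, k, i). ((m, k), i)"]) auto
  then have S2: "((\<lambda>(mk, i). u (fst mk, snd mk, i)) has_sum S) (Sigma ({1..} \<times> UNIV) (\<lambda>_. {1..}))"
    using S by blast
  define v where "v mk = infsum (\<lambda>i. u (fst mk, snd mk, i)) {1..}" for mk
  have v: "((\<lambda>i. u (fst mk, snd mk, i)) has_sum v mk) {1..}" if "mk \<in> {1..} \<times> UNIV" for mk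
    unfolding v_def
    by (intro has_sum_infsum summable_on_SigmaD1[OF has_sum_imp_summable[OF S2] that])
  have "(v has_sum S) ({1..} \<times> UNIV)"
    by (rule has_sum_SigmaD[OF S2]) (use v in auto)
  then have "((\<lambda>X. \<Sum>mk\<in>X. v mk) \<longlongrightarrow> S) (finite_subsets_at_top ({1..} \<times> UNIV))"
    by (simp add: has_sum_def)
  then have "((\<lambda>X. e2pi (- \<sigma>) * exp (- (\<Sum>mk\<in>X. v mk))) \<longlongrightarrow> e2pi (- \<sigma>) * exp (- S))
      (finite_subsets_at_top ({1..} \<times> UNIV))"
    by (intro tendsto_intros)
  moreover have "\<forall>\<^sub>F X in finite_subsets_at_top ({1..} \<times> UNIV). e2pi (- \<sigma>) * exp (- (\<Sum>mk\<in>X. v mk)) =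
      e2pi (- \<sigma>) * (\<Prod>(m, k)\<in>X. one_minus_pow (pq_monomial N \<sigma> \<tau> m k) (prod_exponent N f m k))"
  proof (rule eventually_finite_subsets_at_top_weakI)
    fix X :: "(nat \<times> int) set" assume X: "finite X" "X \<subseteq> {1..} \<times> UNIV"
    have "(\<Prod>(m, k)\<in>X. one_minus_pow (pq_monomial N \<sigma> \<tau> m k) (prod_exponent N f m k)) = (\<Prod>mk\<in>X. exp (- v mk))"
    proof (rule prod.cong[OF refl])
      fix mk assume "mk \<in> X"
      then have "mk \<in> {1..} \<times> UNIV" using X by blast
      from v[OF this] show "(case mk of (m, k) \<Rightarrow> one_minus_pow (pq_monomial N \<sigma> \<tau> m k) (prod_exponent N f m k)) = exp (- v mk)"
        by (auto simp: u_def case_prod_unfold intro: one_minus_pow_eq_exp)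
    qed
    also have "\<dots> = exp (- (\<Sum>mk\<in>X. v mk))" using X by (simp add: exp_sum sum_negf [symmetric])
    finally show "e2pi (- \<sigma>) * exp (- (\<Sum>mk\<in>X. v mk)) =
      e2pi (- \<sigma>) * (\<Prod>(m, k)\<in>X. one_minus_pow (pq_monomial N \<sigma> \<tau> m k) (prod_exponent N f m k))" by simp
  qed
  ultimately show ?thesis
    unfolding has_product_expansion_def exp_S by (rule Lim_transform_eventually)
qed

end

text \<open>The first two conjuncts give the identity its meaning: for each m the powers of q^(1/N)
  are bounded below, as in C((q^(1/N)))[[p]] up to the factor 1/p, and the region of the third
  conjunct contains a neighborhood of the cusp.\<close>

theorem proposition3p13:
  fixes N :: nat and f :: "int \<Rightarrow> int \<Rightarrow> complex \<Rightarrow> complex"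
  assumes "N > 0"
    and "function_on_M_Ell N f"
    and "principally_normalized f"
    and "Hecke_monic N f"
  shows "(\<forall>m \<ge> 1. \<exists>B. \<forall>k < B. prod_exponent N f m k = 0) \<and>
    (\<exists>K > 0. \<forall>\<sigma> \<tau>. Im \<tau> > K \<and> Im \<sigma> > K * Im \<tau> \<longrightarrow> log_series_converges N f \<sigma> \<tau>) \<and>
    (\<forall>\<sigma>\<in>uhp. \<forall>\<tau>\<in>uhp. log_series_converges N f \<sigma> \<tau> \<longrightarrow>
       has_product_expansion N f \<sigma> \<tau> (f 0 1 \<sigma> - f 1 0 \<tau>))"
proof -
  interpret hecke_monic_function N f
    using assms by unfold_locales
  obtain L :: nat where "\<forall>m > 0. \<forall>k < - int L. prod_exponent N f m k = 0"
    using prod_exponent_eq_0 by blast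
  then have "\<forall>m \<ge> 1. \<exists>B. \<forall>k < B. prod_exponent N f m k = 0"
    by (auto simp: Suc_le_eq)
  then show ?thesis
    using log_series_converges_near_infinity product_expansion by blast
qed

end
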